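(* Let a compact connected Lie group $G$ act in a Hamiltonian fashion on an $H$-twisted generalized complex manifold $(M,\mathcal{J})$ with generalized moment map $\mu:M\to\mathfrak{g}^*$ and moment one form $\alpha$, and put $H_G=H+\alpha$. Then the map $$H_G(M,H_G)\to H(\widehat\Omega_G,D_G),\qquad[\gamma]\mapsto[\exp(-\sqrt{-1}\,\mu)\gamma],$$ defines an isomorphism between the $H_G$-twisted equivariant cohomology $H_G(M,H_G)$ and the generalized equivariant cohomology $H(\widehat\Omega_G,D_G)$.
   Context: Generalized complex structures. Let $M$ be a manifold and $H$ a closed real 3-form. $T_{\mathbb C}M\oplus T^*_{\mathbb C}M$ carries the pairing $\langle X+\alpha,Y+\beta\rangle=\frac12(\beta(X)+\alpha(Y))$ and the $H$-twisted Courant bracket $[X+\xi,Y+\eta]=[X,Y]+L_X\eta-L_Y\xi-\frac12 d(\eta(X)-\xi(Y))+\iota_Y\iota_XH$. An $H$-twisted generalized complex structure is an orthogonal bundle map $\mathcal{J}$ of $TM\oplus T^*M$ with $\mathcal{J}^2=-1$ such that sections of its $\sqrt{-1}$-eigenbundle $L$ are closed under this bracket. Hamiltonian actions. Let a compact Lie group $G$ with Lie algebra $\mathfrak{g}$ act on $M$ preserving $\mathcal{J}$, with $H$ $G$-invariant; $\xi_M$ is the vector field induced by $\xi\in\mathfrak{g}$. The action is Hamiltonian if there are a smooth equivariant $\mu:M\to\mathfrak{g}^*$ (generalized moment map) and $\alpha\in\Omega^1(M,\mathfrak{g}^* )$ (moment one form) such that (a) $\xi_M-\sqrt{-1}(d\mu^\xi+\sqrt{-1}\alpha^\xi)\in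 C^\infty(L)$ for all $\xi\in\mathfrak{g}$; (b) $H+\alpha$ is equivariantly closed in the Cartan model. Equivariant cohomology. $\Omega_G=(S\mathfrak{g}^*\otimes\Omega(M))^G$ (complex forms) is the Cartan complex, with $(d_G\gamma)(\xi)=d(\gamma(\xi))-\iota_{\xi_M}\gamma(\xi)$. $\widehat\Omega_G$ is the space of $G$-invariant formal power series on $\mathfrak{g}$ (in the variables of the polynomial ring $S\mathfrak{g}^*$) with coefficients in $\Omega(M)$; $d_G$ extends to it. $H_G(M,H_G)$ is the cohomology of $\widehat\Omega_G$ with differential $d_{G,H_G}=d_G-H_G\wedge$. With $d_H=d-H\wedge$ and $$(\mathcal{A}\gamma)(\xi)=-\iota_{\xi_M}\gamma(\xi)+\sqrt{-1}(d\mu^\xi+\sqrt{-1}\alpha^\xi)\wedge\gamma(\xi),$$ the operator $D_G=d_H+\mathcal{A}$ satisfies $D_G^2=0$ on $\Omega_G$ and extends to $\widehat\Omega_G$; $H(\widehat\Omega_G,D_G)=\ker D_G/\operatorname{im}D_G$ on $\widehat\Omega_G$. $\mu$ is regarded as an element of $\Omega_G$, linear in $\xi$, via $\xi\mapsto\mu^\xi$. *)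

theory Defs
  imports
    "HOL-Analysis.Analysis"
    "HOL-Algebra.Group_Action"
    "HOL-Library.Function_Algebras"
begin

text \<open>
  Functions, vector fields, forms and power series are all function types; addition,
  subtraction, zero and (for scalar functions) multiplication on them are the pointwise
  operations of \<^theory>\<open>HOL-Library.Function_Algebras\<close>.
  Elements of a space that is cut out by a domain (derivations of the smooth functions, forms on
  vector fields, maps on the Lie algebra) are normalised to be zero outside that domain, so
  that equality in HOL is equality of the mathematical objects.
\<close>

section \<open>Smooth manifolds\<close>

text \<open>
  The model of a manifold is a linear subspace V of a Euclidean space, so that every dimension,
  including 0, occurs. Smoothness on a relatively open subset S of V is existence and continuity
  of all iterated directional derivatives along V.
\<close>

primrec Ck_on :: "nat \<Rightarrow> 'e::euclidean_space set \<Rightarrow> 'e set \<Rightarrow> ('e \<Rightarrow> 'b::real_normed_vector) \<Rightarrow> bool" where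
  "Ck_on 0 V S f \<longleftrightarrow> continuous_on S f"
| "Ck_on (Suc k) V S f \<longleftrightarrow> continuous_on S f \<and>
     (\<forall>v\<in>V. \<exists>f'. (\<forall>x\<in>S. ((\<lambda>t. f (x + t *\<^sub>R v)) has_vector_derivative f' x) (at 0)) \<and> Ck_on k V S f')"

definition smooth_on :: "'e::euclidean_space set \<Rightarrow> 'e set \<Rightarrow> ('e \<Rightarrow> 'b::real_normed_vector) \<Rightarrow> bool" where
  "smooth_on V S f \<longleftrightarrow> (\<forall>k. Ck_on k V S f)"

text \<open>
  The underlying space of a manifold is a whole type; a chart is a pair of its domain and its
  coordinate map (only the values on the domain matter).
\<close>

record ('m, 'e) manifold =
  model :: "'e set"
  charts :: "('m set \<times> ('m \<Rightarrow> 'e)) set"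

definition smooth_manifold ::
  "('m::{t2_space,second_countable_topology}, 'e::euclidean_space) manifold \<Rightarrow> bool" where
  "smooth_manifold M \<longleftrightarrow>
     subspace (model M) \<and>
     (\<Union>(U, \<phi>)\<in>charts M. U) = UNIV \<and>
     (\<forall>(U, \<phi>)\<in>charts M. open U \<and> openin (top_of_set (model M)) (\<phi> ` U) \<and>
        (\<exists>\<psi>. homeomorphism U (\<phi> ` U) \<phi> \<psi>)) \<and>
     (\<forall>(U, \<phi>)\<in>charts M. \<forall>(W, \<psi>)\<in>charts M.
        smooth_on (model M) (\<phi> ` (U \<inter> W)) (\<psi> \<circ> inv_into U \<phi>))"

definition smooth_funs ::
  "('m::topological_space, 'e::euclidean_space) manifold \<Rightarrow> ('m \<Rightarrow> 'b::real_normed_vector) set" where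
  "smooth_funs M = {f. \<forall>(U, \<phi>)\<in>charts M. smooth_on (model M) (\<phi> ` U) (f \<circ> inv_into U \<phi>)}"

definition smooth_map ::
  "('m::topological_space, 'e::euclidean_space) manifold \<Rightarrow>
   ('n::topological_space, 'f::euclidean_space) manifold \<Rightarrow> ('m \<Rightarrow> 'n) \<Rightarrow> bool" where
  "smooth_map M N F \<longleftrightarrow> continuous_on UNIV F \<and>
     (\<forall>(U, \<phi>)\<in>charts M. \<forall>(W, \<psi>)\<in>charts N.
        smooth_on (model M) (\<phi> ` (U \<inter> F -` W)) (\<psi> \<circ> F \<circ> inv_into U \<phi>))"

definition prod_manifold ::
  "('m, 'e) manifold \<Rightarrow> ('n, 'f) manifold \<Rightarrow> ('m \<times> 'n, 'e \<times> 'f) manifold" where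
  "prod_manifold M N =
     \<lparr>model = model M \<times> model N,
      charts = {(U \<times> W, map_prod \<phi> \<psi>) | U \<phi> W \<psi>. (U, \<phi>) \<in> charts M \<and> (W, \<psi>) \<in> charts N}\<rparr>"


section \<open>Complex vector fields and forms\<close>

text \<open>
  Sections of the complexified tangent bundle are the complex derivations of the algebra of
  complex-valued smooth functions; the real vector fields are those preserving real-valued
  functions.
\<close>

type_synonym 'm vfield = "('m \<Rightarrow> complex) \<Rightarrow> ('m \<Rightarrow> complex)"

definition real_valued :: "('m \<Rightarrow> complex) \<Rightarrow> bool" where
  "real_valued f \<longleftrightarrow> (\<forall>p. f p \<in> \<real>)"

definition vector_fields ::
  "('m::topological_space, 'e::euclidean_space) manifold \<Rightarrow> 'm vfield set" where
  "vector_fields M = {X.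
     (\<forall>f\<in>smooth_funs M. X f \<in> smooth_funs M) \<and>
     (\<forall>f\<in>smooth_funs M. \<forall>g\<in>smooth_funs M. X (f + g) = X f + X g) \<and>
     (\<forall>f\<in>smooth_funs M. \<forall>c. X (\<lambda>p. c * f p) = (\<lambda>p. c * X f p)) \<and>
     (\<forall>f\<in>smooth_funs M. \<forall>g\<in>smooth_funs M. X (f * g) = X f * g + f * X g) \<and>
     (\<forall>f. f \<notin> smooth_funs M \<longrightarrow> X f = 0)}"

definition real_vfield ::
  "('m::topological_space, 'e::euclidean_space) manifold \<Rightarrow> 'm vfield \<Rightarrow> bool" where
  "real_vfield M X \<longleftrightarrow> X \<in> vector_fields M \<and>
     (\<forall>f\<in>smooth_funs M. real_valued f \<longrightarrow> real_valued (X f))"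

definition lie_bracket :: "'m vfield \<Rightarrow> 'm vfield \<Rightarrow> 'm vfield" where
  "lie_bracket X Y = (\<lambda>f. X (Y f) - Y (X f))"

definition vf_mult :: "('m \<Rightarrow> complex) \<Rightarrow> 'm vfield \<Rightarrow> 'm vfield" where
  "vf_mult h X = (\<lambda>f. h * X f)"

text \<open>
  A form of mixed degree assigns to every finite list of vector fields a smooth function; its
  component of degree k is the restriction to lists of length k, and is alternating and
  multilinear over the smooth functions. (Components above the dimension vanish automatically,
  hence this is the direct sum of the spaces of k-forms.)
\<close>

type_synonym 'm form = "'m vfield list \<Rightarrow> 'm \<Rightarrow> complex"

definition forms :: "('m::topological_space, 'e::euclidean_space) manifold \<Rightarrow> 'm form set" where
  "forms M = {\<omega>.
     (\<forall>Xs. set Xs \<subseteq> vector_fields M \<longrightarrow> \<omega> Xs \<in> smooth_funs M) \<and>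
     (\<forall>Xs. \<not> set Xs \<subseteq> vector_fields M \<longrightarrow> \<omega> Xs = 0) \<and>
     (\<forall>Xs Ys. \<forall>X\<in>vector_fields M. \<forall>Y\<in>vector_fields M.
        set Xs \<subseteq> vector_fields M \<and> set Ys \<subseteq> vector_fields M \<longrightarrow>
        \<omega> (Xs @ (X + Y) # Ys) = \<omega> (Xs @ X # Ys) + \<omega> (Xs @ Y # Ys)) \<and>
     (\<forall>Xs Ys. \<forall>X\<in>vector_fields M. \<forall>h\<in>smooth_funs M.
        set Xs \<subseteq> vector_fields M \<and> set Ys \<subseteq> vector_fields M \<longrightarrow>
        \<omega> (Xs @ vf_mult h X # Ys) = h * \<omega> (Xs @ X # Ys)) \<and>
     (\<forall>Xs. set Xs \<subseteq> vector_fields M \<and> \<not> distinct Xs \<longrightarrow> \<omega> Xs = 0)}"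

definition kforms ::
  "nat \<Rightarrow> ('m::topological_space, 'e::euclidean_space) manifold \<Rightarrow> 'm form set" where
  "kforms k M = {\<omega>\<in>forms M. \<forall>Xs. length Xs \<noteq> k \<longrightarrow> \<omega> Xs = 0}"

definition real_form ::
  "('m::topological_space, 'e::euclidean_space) manifold \<Rightarrow> 'm form \<Rightarrow> bool" where
  "real_form M \<omega> \<longleftrightarrow> (\<forall>Xs. (\<forall>X\<in>set Xs. real_vfield M X) \<longrightarrow> real_valued (\<omega> Xs))"

definition fun_form :: "('m \<Rightarrow> complex) \<Rightarrow> 'm form" where
  "fun_form f = (\<lambda>Xs. if Xs = [] then f else 0)"

definition form_scale :: "complex \<Rightarrow> 'm form \<Rightarrow> 'm form" where
  "form_scale c \<omega> = (\<lambda>Xs p. c * \<omega> Xs p)"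

text \<open>
  Sum over all ways to split the arguments: S is the set of positions fed to the first factor and
  the sign is that of the corresponding shuffle. No factorials occur, so that for one-forms
  the value on X, Y is a(X) b(Y) - a(Y) b(X).
\<close>

definition shuffle_sign :: "nat \<Rightarrow> nat set \<Rightarrow> 'm \<Rightarrow> complex" where
  "shuffle_sign n S = (\<lambda>_. (-1) ^ card {(i, j). i \<in> S \<and> j \<in> {..<n} - S \<and> j < i})"

definition wedge :: "'m form \<Rightarrow> 'm form \<Rightarrow> 'm form" where
  "wedge \<omega> \<eta> = (\<lambda>Xs. \<Sum>S\<in>Pow {..<length Xs}.
     shuffle_sign (length Xs) S * \<omega> (nths Xs S) * \<eta> (nths Xs (- S)))"

definition interior :: "'m vfield \<Rightarrow> 'm form \<Rightarrow> 'm form" where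
  "interior X \<omega> = (\<lambda>Xs. \<omega> (X # Xs))"

definition ext_d ::
  "('m::topological_space, 'e::euclidean_space) manifold \<Rightarrow> 'm form \<Rightarrow> 'm form" where
  "ext_d M \<omega> = (\<lambda>Xs. if set Xs \<subseteq> vector_fields M then
       (\<Sum>i<length Xs. (-1) ^ i * (Xs ! i) (\<omega> (nths Xs (- {i})))) +
       (\<Sum>j<length Xs. \<Sum>i<j. (-1) ^ (i + j) *
          \<omega> (lie_bracket (Xs ! i) (Xs ! j) # nths Xs (- {i, j})))
     else 0)"

definition lie_derivative ::
  "('m::topological_space, 'e::euclidean_space) manifold \<Rightarrow> 'm vfield \<Rightarrow> 'm form \<Rightarrow> 'm form" where
  "lie_derivative M X \<omega> = ext_d M (interior X \<omega>) + interior X (ext_d M \<omega>)"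

text \<open>Push-forward of vector fields and pull-back of forms along a diffeomorphism.\<close>

definition push_vf :: "('m \<Rightarrow> 'm) \<Rightarrow> 'm vfield \<Rightarrow> 'm vfield" where
  "push_vf \<phi> X = (\<lambda>f. X (f \<circ> \<phi>) \<circ> inv_into UNIV \<phi>)"

definition pull_form :: "('m \<Rightarrow> 'm) \<Rightarrow> 'm form \<Rightarrow> 'm form" where
  "pull_form \<phi> \<omega> = (\<lambda>Xs. \<omega> (map (push_vf \<phi>) Xs) \<circ> \<phi>)"


section \<open>Generalized complex structures\<close>

text \<open>
  Sections of the complexification of the sum of the tangent and cotangent bundle; real sections
  are sections of the real bundle.
\<close>

type_synonym 'm gsection = "'m vfield \<times> 'm form"

definition gsections ::
  "('m::topological_space, 'e::euclidean_space) manifold \<Rightarrow> 'm gsection set" where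
  "gsections M = vector_fields M \<times> kforms 1 M"

definition real_gsection ::
  "('m::topological_space, 'e::euclidean_space) manifold \<Rightarrow> 'm gsection \<Rightarrow> bool" where
  "real_gsection M e \<longleftrightarrow> e \<in> gsections M \<and> real_vfield M (fst e) \<and> real_form M (snd e)"

definition gs_mult :: "('m \<Rightarrow> complex) \<Rightarrow> 'm gsection \<Rightarrow> 'm gsection" where
  "gs_mult h = (\<lambda>(X, \<xi>). (vf_mult h X, \<lambda>Xs. h * \<xi> Xs))"

definition gpairing :: "'m gsection \<Rightarrow> 'm gsection \<Rightarrow> 'm \<Rightarrow> complex" where
  "gpairing = (\<lambda>(X, \<alpha>) (Y, \<beta>). (\<lambda>p. 1/2 * (\<beta> [X] p + \<alpha> [Y] p)))"

definition courant_bracket ::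
  "('m::topological_space, 'e::euclidean_space) manifold \<Rightarrow> 'm form \<Rightarrow>
   'm gsection \<Rightarrow> 'm gsection \<Rightarrow> 'm gsection" where
  "courant_bracket M H = (\<lambda>(X, \<xi>) (Y, \<eta>).
     (lie_bracket X Y,
      lie_derivative M X \<eta> - lie_derivative M Y \<xi>
        - form_scale (1/2) (ext_d M (fun_form (\<eta> [X] - \<xi> [Y])))
        + interior Y (interior X H)))"

text \<open>
  A bundle map of the real bundle is represented by its complexification on sections: a map on
  complex sections which is linear over the complex-valued smooth functions and preserves real
  sections.
\<close>

definition gbundle_map ::
  "('m::topological_space, 'e::euclidean_space) manifold \<Rightarrow> ('m gsection \<Rightarrow> 'm gsection) \<Rightarrow> bool" where
  "gbundle_map M J \<longleftrightarrow>
     (\<forall>e\<in>gsections M. J e \<in> gsections M) \<and>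
     (\<forall>e. real_gsection M e \<longrightarrow> real_gsection M (J e)) \<and>
     (\<forall>e\<in>gsections M. \<forall>e'\<in>gsections M. J (e + e') = J e + J e') \<and>
     (\<forall>e\<in>gsections M. \<forall>h\<in>smooth_funs M. J (gs_mult h e) = gs_mult h (J e))"

definition eigen_sections ::
  "('m::topological_space, 'e::euclidean_space) manifold \<Rightarrow> ('m gsection \<Rightarrow> 'm gsection) \<Rightarrow>
   'm gsection set" where
  "eigen_sections M J = {e\<in>gsections M. J e = gs_mult (\<lambda>_. \<i>) e}"

definition closed_real_3form ::
  "('m::topological_space, 'e::euclidean_space) manifold \<Rightarrow> 'm form \<Rightarrow> bool" where
  "closed_real_3form M H \<longleftrightarrow> H \<in> kforms 3 M \<and> real_form M H \<and> ext_d M H = 0"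

definition gen_complex_structure ::
  "('m::topological_space, 'e::euclidean_space) manifold \<Rightarrow> 'm form \<Rightarrow>
   ('m gsection \<Rightarrow> 'm gsection) \<Rightarrow> bool" where
  "gen_complex_structure M H J \<longleftrightarrow>
     gbundle_map M J \<and>
     (\<forall>e\<in>gsections M. \<forall>e'\<in>gsections M. gpairing (J e) (J e') = gpairing e e') \<and>
     (\<forall>e\<in>gsections M. J (J e) = - e) \<and>
     (\<forall>e\<in>eigen_sections M J. \<forall>e'\<in>eigen_sections M J.
        courant_bracket M H e e' \<in> eigen_sections M J)"


section \<open>Lie groups and actions\<close>

definition lie_group ::
  "('g::{t2_space,second_countable_topology}, 'f::euclidean_space) manifold \<Rightarrow> 'g monoid \<Rightarrow> bool" where
  "lie_group N G \<longleftrightarrow>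
     smooth_manifold N \<and> group G \<and> carrier G = UNIV \<and>
     smooth_map (prod_manifold N N) N (\<lambda>(g, h). g \<otimes>\<^bsub>G\<^esub> h) \<and>
     smooth_map N N (\<lambda>g. inv\<^bsub>G\<^esub> g)"

definition smooth_action ::
  "('g::topological_space, 'f::euclidean_space) manifold \<Rightarrow> 'g monoid \<Rightarrow>
   ('m::topological_space, 'e::euclidean_space) manifold \<Rightarrow> ('g \<Rightarrow> 'm \<Rightarrow> 'm) \<Rightarrow> bool" where
  "smooth_action N G M \<rho> \<longleftrightarrow>
     group_action G UNIV \<rho> \<and> smooth_map (prod_manifold N M) M (\<lambda>(g, p). \<rho> g p)"

text \<open>The Lie algebra, as the tangent space at the unit, i.e. the space of point derivations there.\<close>

type_synonym 'g lie = "('g \<Rightarrow> real) \<Rightarrow> real"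

definition lie_algebra ::
  "('g::topological_space, 'f::euclidean_space) manifold \<Rightarrow> 'g monoid \<Rightarrow> 'g lie set" where
  "lie_algebra N G = {\<xi>.
     (\<forall>f\<in>smooth_funs N. \<forall>h\<in>smooth_funs N. \<xi> (f + h) = \<xi> f + \<xi> h) \<and>
     (\<forall>f\<in>smooth_funs N. \<forall>c. \<xi> (\<lambda>g. c * f g) = c * \<xi> f) \<and>
     (\<forall>f\<in>smooth_funs N. \<forall>h\<in>smooth_funs N. \<xi> (f * h) = \<xi> f * h \<one>\<^bsub>G\<^esub> + f \<one>\<^bsub>G\<^esub> * \<xi> h) \<and>
     (\<forall>f. f \<notin> smooth_funs N \<longrightarrow> \<xi> f = 0)}"

definition lie_scale :: "real \<Rightarrow> 'g lie \<Rightarrow> 'g lie" where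
  "lie_scale c \<xi> = (\<lambda>f. c * \<xi> f)"

text \<open>The derivative at the unit of conjugation by g.\<close>

definition Ad :: "'g monoid \<Rightarrow> 'g \<Rightarrow> 'g lie \<Rightarrow> 'g lie" where
  "Ad G g \<xi> = (\<lambda>f. \<xi> (\<lambda>h. f (g \<otimes>\<^bsub>G\<^esub> h \<otimes>\<^bsub>G\<^esub> inv\<^bsub>G\<^esub> g)))"

text \<open>
  The vector field induced by \<open>\<xi>\<close>: at p it is the image of \<open>\<xi>\<close> under the derivative
  at the unit of the orbit map of p, i.e. the velocity of \<open>exp (t \<xi>) p\<close> at t = 0.
\<close>

definition fundamental_vf ::
  "('m::topological_space, 'e::euclidean_space) manifold \<Rightarrow> ('g \<Rightarrow> 'm \<Rightarrow> 'm) \<Rightarrow> 'g lie \<Rightarrow> 'm vfield" where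
  "fundamental_vf M \<rho> \<xi> = (\<lambda>f. if f \<in> smooth_funs M
     then (\<lambda>p. Complex (\<xi> (\<lambda>g. Re (f (\<rho> g p)))) (\<xi> (\<lambda>g. Im (f (\<rho> g p)))))
     else 0)"


section \<open>The Cartan complex and its completion\<close>

text \<open>
  A formal power series on the Lie algebra with values in forms is the sequence of its homogeneous
  components. A homogeneous polynomial of degree k is the restriction of a k-linear map
  to the diagonal.
\<close>

type_synonym ('g, 'm) fseries = "nat \<Rightarrow> 'g lie \<Rightarrow> 'm form"

definition homogeneous_poly ::
  "('g::topological_space, 'f::euclidean_space) manifold \<Rightarrow> 'g monoid \<Rightarrow>
   ('m::topological_space, 'e::euclidean_space) manifold \<Rightarrow> nat \<Rightarrow> ('g lie \<Rightarrow> 'm form) \<Rightarrow> bool" where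
  "homogeneous_poly N G M k P \<longleftrightarrow>
     (\<exists>B.
       (\<forall>\<xi>s. set \<xi>s \<subseteq> lie_algebra N G \<and> length \<xi>s = k \<longrightarrow> B \<xi>s \<in> forms M) \<and>
       (\<forall>\<xi>s \<eta>s. \<forall>\<xi>\<in>lie_algebra N G. \<forall>\<eta>\<in>lie_algebra N G.
          set \<xi>s \<subseteq> lie_algebra N G \<and> set \<eta>s \<subseteq> lie_algebra N G \<and> length \<xi>s + length \<eta>s + 1 = k \<longrightarrow>
          B (\<xi>s @ (\<xi> + \<eta>) # \<eta>s) = B (\<xi>s @ \<xi> # \<eta>s) + B (\<xi>s @ \<eta> # \<eta>s)) \<and>
       (\<forall>\<xi>s \<eta>s c. \<forall>\<xi>\<in>lie_algebra N G.
          set \<xi>s \<subseteq> lie_algebra N G \<and> set \<eta>s \<subseteq> lie_algebra N G \<and> length \<xi>s + length \<eta>s + 1 = k \<longrightarrow>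
          B (\<xi>s @ lie_scale c \<xi> # \<eta>s) = form_scale (of_real c) (B (\<xi>s @ \<xi> # \<eta>s))) \<and>
       (\<forall>\<xi>\<in>lie_algebra N G. P \<xi> = B (replicate k \<xi>))) \<and>
     (\<forall>\<xi>. \<xi> \<notin> lie_algebra N G \<longrightarrow> P \<xi> = 0)"

definition G_invariant ::
  "('g::topological_space, 'f::euclidean_space) manifold \<Rightarrow> 'g monoid \<Rightarrow> ('g \<Rightarrow> 'm \<Rightarrow> 'm) \<Rightarrow>
   ('g, 'm) fseries \<Rightarrow> bool" where
  "G_invariant N G \<rho> \<gamma> \<longleftrightarrow>
     (\<forall>n g. \<forall>\<xi>\<in>lie_algebra N G. pull_form (\<rho> g) (\<gamma> n (Ad G g \<xi>)) = \<gamma> n \<xi>)"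

definition completed_cartan ::
  "('g::topological_space, 'f::euclidean_space) manifold \<Rightarrow> 'g monoid \<Rightarrow>
   ('m::topological_space, 'e::euclidean_space) manifold \<Rightarrow> ('g \<Rightarrow> 'm \<Rightarrow> 'm) \<Rightarrow>
   ('g, 'm) fseries set" where
  "completed_cartan N G M \<rho> = {\<gamma>. (\<forall>n. homogeneous_poly N G M n (\<gamma> n)) \<and> G_invariant N G \<rho> \<gamma>}"

definition cartan_complex ::
  "('g::topological_space, 'f::euclidean_space) manifold \<Rightarrow> 'g monoid \<Rightarrow>
   ('m::topological_space, 'e::euclidean_space) manifold \<Rightarrow> ('g \<Rightarrow> 'm \<Rightarrow> 'm) \<Rightarrow>
   ('g, 'm) fseries set" where
  "cartan_complex N G M \<rho> = {\<gamma>\<in>completed_cartan N G M \<rho>. finite {n. \<gamma> n \<noteq> 0}}"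

definition series_scale :: "complex \<Rightarrow> ('g, 'm) fseries \<Rightarrow> ('g, 'm) fseries" where
  "series_scale c \<gamma> = (\<lambda>n \<xi>. form_scale c (\<gamma> n \<xi>))"

definition series_wedge :: "('g, 'm) fseries \<Rightarrow> ('g, 'm) fseries \<Rightarrow> ('g, 'm) fseries" where
  "series_wedge \<beta> \<gamma> = (\<lambda>n \<xi>. \<Sum>k\<le>n. wedge (\<beta> k \<xi>) (\<gamma> (n - k) \<xi>))"

text \<open>
  Contraction with \<open>\<xi>\<^sub>M\<close> (here, and likewise multiplication with \<open>d\<mu>\<^sup>\<xi>\<close> and \<open>\<alpha>\<^sup>\<xi>\<close> below) is
  linear in \<open>\<xi>\<close> and thus raises the polynomial degree by one.
\<close>

definition equiv_d ::
  "('m::topological_space, 'e::euclidean_space) manifold \<Rightarrow> ('g \<Rightarrow> 'm \<Rightarrow> 'm) \<Rightarrow>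
   ('g, 'm) fseries \<Rightarrow> ('g, 'm) fseries" where
  "equiv_d M \<rho> \<gamma> = (\<lambda>n \<xi>. ext_d M (\<gamma> n \<xi>) -
     (case n of 0 \<Rightarrow> 0 | Suc m \<Rightarrow> interior (fundamental_vf M \<rho> \<xi>) (\<gamma> m \<xi>)))"


section \<open>Hamiltonian actions\<close>

text \<open>
  A moment map is given as \<open>\<mu> p \<xi>\<close>, the pairing of \<open>\<mu>(p)\<close> with \<open>\<xi>\<close>.
\<close>

definition moment_fun :: "('m \<Rightarrow> 'g lie \<Rightarrow> real) \<Rightarrow> 'g lie \<Rightarrow> 'm \<Rightarrow> complex" where
  "moment_fun \<mu> \<xi> = (\<lambda>p. complex_of_real (\<mu> p \<xi>))"

definition equivariant_moment_map ::
  "('g::topological_space, 'f::euclidean_space) manifold \<Rightarrow> 'g monoid \<Rightarrow>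
   ('m::topological_space, 'e::euclidean_space) manifold \<Rightarrow> ('g \<Rightarrow> 'm \<Rightarrow> 'm) \<Rightarrow>
   ('m \<Rightarrow> 'g lie \<Rightarrow> real) \<Rightarrow> bool" where
  "equivariant_moment_map N G M \<rho> \<mu> \<longleftrightarrow>
     (\<forall>p. \<forall>\<xi>\<in>lie_algebra N G. \<forall>\<eta>\<in>lie_algebra N G. \<mu> p (\<xi> + \<eta>) = \<mu> p \<xi> + \<mu> p \<eta>) \<and>
     (\<forall>p c. \<forall>\<xi>\<in>lie_algebra N G. \<mu> p (lie_scale c \<xi>) = c * \<mu> p \<xi>) \<and>
     (\<forall>\<xi>\<in>lie_algebra N G. moment_fun \<mu> \<xi> \<in> smooth_funs M) \<and>
     (\<forall>g p. \<forall>\<xi>\<in>lie_algebra N G. \<mu> (\<rho> g p) \<xi> = \<mu> p (Ad G (inv\<^bsub>G\<^esub> g) \<xi>))"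

definition lie_dual_1form ::
  "('g::topological_space, 'f::euclidean_space) manifold \<Rightarrow> 'g monoid \<Rightarrow>
   ('m::topological_space, 'e::euclidean_space) manifold \<Rightarrow> ('g lie \<Rightarrow> 'm form) \<Rightarrow> bool" where
  "lie_dual_1form N G M \<alpha> \<longleftrightarrow>
     (\<forall>\<xi>\<in>lie_algebra N G. \<alpha> \<xi> \<in> kforms 1 M \<and> real_form M (\<alpha> \<xi>)) \<and>
     (\<forall>\<xi>\<in>lie_algebra N G. \<forall>\<eta>\<in>lie_algebra N G. \<alpha> (\<xi> + \<eta>) = \<alpha> \<xi> + \<alpha> \<eta>) \<and>
     (\<forall>c. \<forall>\<xi>\<in>lie_algebra N G. \<alpha> (lie_scale c \<xi>) = form_scale (of_real c) (\<alpha> \<xi>))"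

text \<open>The element \<open>H\<^sub>G = H + \<alpha>\<close> of the Cartan complex.\<close>

definition equiv_3form ::
  "('g::topological_space, 'f::euclidean_space) manifold \<Rightarrow> 'g monoid \<Rightarrow> 'm form \<Rightarrow>
   ('g lie \<Rightarrow> 'm form) \<Rightarrow> ('g, 'm) fseries" where
  "equiv_3form N G H \<alpha> = (\<lambda>n \<xi>.
     if \<xi> \<in> lie_algebra N G then (if n = 0 then H else if n = 1 then \<alpha> \<xi> else 0) else 0)"

text \<open>The one-form \<open>d\<mu>\<^sup>\<xi> + \<i> \<alpha>\<^sup>\<xi>\<close>.\<close>

definition moment_1form ::
  "('m::topological_space, 'e::euclidean_space) manifold \<Rightarrow> ('m \<Rightarrow> 'g lie \<Rightarrow> real) \<Rightarrow>
   ('g lie \<Rightarrow> 'm form) \<Rightarrow> 'g lie \<Rightarrow> 'm form" where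
  "moment_1form M \<mu> \<alpha> \<xi> = ext_d M (fun_form (moment_fun \<mu> \<xi>)) + form_scale \<i> (\<alpha> \<xi>)"

definition hamiltonian_action ::
  "('g::topological_space, 'f::euclidean_space) manifold \<Rightarrow> 'g monoid \<Rightarrow>
   ('m::topological_space, 'e::euclidean_space) manifold \<Rightarrow> ('g \<Rightarrow> 'm \<Rightarrow> 'm) \<Rightarrow>
   'm form \<Rightarrow> ('m gsection \<Rightarrow> 'm gsection) \<Rightarrow>
   ('m \<Rightarrow> 'g lie \<Rightarrow> real) \<Rightarrow> ('g lie \<Rightarrow> 'm form) \<Rightarrow> bool" where
  "hamiltonian_action N G M \<rho> H J \<mu> \<alpha> \<longleftrightarrow>
     smooth_action N G M \<rho> \<and>
     (\<forall>g. \<forall>(X, \<eta>)\<in>gsections M.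
        J (push_vf (\<rho> g) X, pull_form (\<rho> (inv\<^bsub>G\<^esub> g)) \<eta>) =
        (case J (X, \<eta>) of (Y, \<zeta>) \<Rightarrow> (push_vf (\<rho> g) Y, pull_form (\<rho> (inv\<^bsub>G\<^esub> g)) \<zeta>))) \<and>
     (\<forall>g. pull_form (\<rho> g) H = H) \<and>
     equivariant_moment_map N G M \<rho> \<mu> \<and>
     lie_dual_1form N G M \<alpha> \<and>
     (\<forall>\<xi>\<in>lie_algebra N G.
        (fundamental_vf M \<rho> \<xi>, form_scale (- \<i>) (moment_1form M \<mu> \<alpha> \<xi>)) \<in> eigen_sections M J) \<and>
     equiv_3form N G H \<alpha> \<in> cartan_complex N G M \<rho> \<and>
     equiv_d M \<rho> (equiv_3form N G H \<alpha>) = 0"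


section \<open>The two differentials and their cohomology\<close>

definition twisted_equiv_d ::
  "('g::topological_space, 'f::euclidean_space) manifold \<Rightarrow> 'g monoid \<Rightarrow>
   ('m::topological_space, 'e::euclidean_space) manifold \<Rightarrow> ('g \<Rightarrow> 'm \<Rightarrow> 'm) \<Rightarrow>
   'm form \<Rightarrow> ('g lie \<Rightarrow> 'm form) \<Rightarrow> ('g, 'm) fseries \<Rightarrow> ('g, 'm) fseries" where
  "twisted_equiv_d N G M \<rho> H \<alpha> \<gamma> = equiv_d M \<rho> \<gamma> - series_wedge (equiv_3form N G H \<alpha>) \<gamma>"

definition twisted_d ::
  "('m::topological_space, 'e::euclidean_space) manifold \<Rightarrow> 'm form \<Rightarrow> 'm form \<Rightarrow> 'm form" where
  "twisted_d M H \<omega> = ext_d M \<omega> - wedge H \<omega>"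

definition moment_op ::
  "('m::topological_space, 'e::euclidean_space) manifold \<Rightarrow> ('g \<Rightarrow> 'm \<Rightarrow> 'm) \<Rightarrow>
   ('m \<Rightarrow> 'g lie \<Rightarrow> real) \<Rightarrow> ('g lie \<Rightarrow> 'm form) \<Rightarrow> ('g, 'm) fseries \<Rightarrow> ('g, 'm) fseries" where
  "moment_op M \<rho> \<mu> \<alpha> \<gamma> = (\<lambda>n \<xi>. case n of 0 \<Rightarrow> 0 | Suc m \<Rightarrow>
     - interior (fundamental_vf M \<rho> \<xi>) (\<gamma> m \<xi>)
     + wedge (form_scale \<i> (moment_1form M \<mu> \<alpha> \<xi>)) (\<gamma> m \<xi>))"

definition generalized_equiv_d ::
  "('m::topological_space, 'e::euclidean_space) manifold \<Rightarrow> ('g \<Rightarrow> 'm \<Rightarrow> 'm) \<Rightarrow> 'm form \<Rightarrow>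
   ('m \<Rightarrow> 'g lie \<Rightarrow> real) \<Rightarrow> ('g lie \<Rightarrow> 'm form) \<Rightarrow> ('g, 'm) fseries \<Rightarrow> ('g, 'm) fseries" where
  "generalized_equiv_d M \<rho> H \<mu> \<alpha> \<gamma> = (\<lambda>n \<xi>. twisted_d M H (\<gamma> n \<xi>)) + moment_op M \<rho> \<mu> \<alpha> \<gamma>"

text \<open>
  The power series \<open>exp (- \<i> \<mu>)\<close>; since \<open>\<mu>\<close> is linear in \<open>\<xi>\<close>, its component of
  degree k is \<open>(- \<i> \<mu>\<^sup>\<xi>)^k / k!\<close>.
\<close>

definition exp_moment ::
  "('g::topological_space, 'f::euclidean_space) manifold \<Rightarrow> 'g monoid \<Rightarrow>
   ('m \<Rightarrow> 'g lie \<Rightarrow> real) \<Rightarrow> ('g, 'm) fseries" where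
  "exp_moment N G \<mu> = (\<lambda>k \<xi>. if \<xi> \<in> lie_algebra N G
     then fun_form (\<lambda>p. (- \<i> * moment_fun \<mu> \<xi> p) ^ k / fact k) else 0)"

text \<open>
  Cohomology of an operator D on a space C of power series: cosets of the image in the kernel,
  with the induced vector space operations.
\<close>

definition cocycles :: "('g, 'm) fseries set \<Rightarrow> (('g, 'm) fseries \<Rightarrow> ('g, 'm) fseries) \<Rightarrow> ('g, 'm) fseries set" where
  "cocycles C D = {\<gamma>\<in>C. D \<gamma> = 0}"

definition coh_class ::
  "('g, 'm) fseries set \<Rightarrow> (('g, 'm) fseries \<Rightarrow> ('g, 'm) fseries) \<Rightarrow> ('g, 'm) fseries \<Rightarrow> ('g, 'm) fseries set" where
  "coh_class C D \<gamma> = {\<gamma> + D \<beta> | \<beta>. \<beta> \<in> C}"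

definition cohomology ::
  "('g, 'm) fseries set \<Rightarrow> (('g, 'm) fseries \<Rightarrow> ('g, 'm) fseries) \<Rightarrow> ('g, 'm) fseries set set" where
  "cohomology C D = coh_class C D ` cocycles C D"

definition coh_add :: "('g, 'm) fseries set \<Rightarrow> ('g, 'm) fseries set \<Rightarrow> ('g, 'm) fseries set" where
  "coh_add a b = {x + y | x y. x \<in> a \<and> y \<in> b}"

definition coh_scale ::
  "('g, 'm) fseries set \<Rightarrow> (('g, 'm) fseries \<Rightarrow> ('g, 'm) fseries) \<Rightarrow> complex \<Rightarrow>
   ('g, 'm) fseries set \<Rightarrow> ('g, 'm) fseries set" where
  "coh_scale C D c a = {series_scale c x + D \<beta> | x \<beta>. x \<in> a \<and> \<beta> \<in> C}"

definition cohomology_iso ::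
  "('g, 'm) fseries set \<Rightarrow> (('g, 'm) fseries \<Rightarrow> ('g, 'm) fseries) \<Rightarrow>
   (('g, 'm) fseries \<Rightarrow> ('g, 'm) fseries) \<Rightarrow>
   (('g, 'm) fseries set \<Rightarrow> ('g, 'm) fseries set) \<Rightarrow> bool" where
  "cohomology_iso C D D' \<Phi> \<longleftrightarrow>
     bij_betw \<Phi> (cohomology C D) (cohomology C D') \<and>
     (\<forall>a\<in>cohomology C D. \<forall>b\<in>cohomology C D. \<Phi> (coh_add a b) = coh_add (\<Phi> a) (\<Phi> b)) \<and>
     (\<forall>c. \<forall>a\<in>cohomology C D. \<Phi> (coh_scale C D c a) = coh_scale C D' c (\<Phi> a))"

end

theory Submission
  imports Defs
begin

text \<open>
  The two differentials are conjugate. Write \<open>d\<^sub>G\<^sub>H\<close> for the twisted equivariant differential.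
  On the component at \<open>\<xi>\<close> both \<open>D\<^sub>G\<close> and \<open>d\<^sub>G\<^sub>H\<close> consist of \<open>d - H\<and>\<close> and of the degree-raising
  operator \<open>- \<iota> - \<alpha>\<^sup>\<xi>\<and>\<close>, because \<open>\<i> (\<i> \<alpha>\<^sup>\<xi>) = - \<alpha>\<^sup>\<xi>\<close>; the only difference is the term
  \<open>\<i> d\<mu>\<^sup>\<xi>\<and>\<close> of \<open>D\<^sub>G\<close>. Multiplication by a function commutes with everything here except \<open>d\<close>, and
  \<open>d (exp (- \<i> \<mu>) \<gamma>) = exp (- \<i> \<mu>) (d\<gamma> - \<i> d\<mu> \<and> \<gamma>)\<close>, so the Leibniz term cancels the extra
  term and \<open>D\<^sub>G (exp (- \<i> \<mu>) \<gamma>) = exp (- \<i> \<mu>) d\<^sub>G\<^sub>H \<gamma>\<close>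
  (lemma \<open>generalized_equiv_d_exp_moment\<close>).

  In each polynomial degree \<open>exp (- \<i> \<mu>)\<close> is a finite sum, and equivariance and linearity of \<open>\<mu>\<close>
  make it preserve the completed Cartan complex (\<open>exp_moment_preserves_completed_cartan\<close>). The moment
  map \<open>- \<mu>\<close> satisfies the same conditions, and its exponential is the inverse
  (\<open>exp_moment_inverse\<close>). A linear bijection of a space that conjugates two
  operators induces an isomorphism of their cohomologies, by taking the image of each
  coset (\<open>cohomology_iso_conjugation\<close>).

  Forms are alternating multilinear maps on derivations, and the Leibniz rule
  \<open>d (h \<omega>) = dh \<and> \<omega> + h d\<omega>\<close> follows from the formula for \<open>d\<close>: the terms containing Lie brackets are linear over functions, and the remaining ones
  obey the product rule for derivations.
\<close>


section \<open>The algebra of smooth functions\<close>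

lemma Ck_on_SucD:
  assumes "Ck_on (Suc k) V S f" "v \<in> V"
  obtains f' where "\<forall>x\<in>S. ((\<lambda>t. f (x + t *\<^sub>R v)) has_vector_derivative f' x) (at 0)"
    and "Ck_on k V S f'"
  using assms unfolding Ck_on.simps by blast

lemma Ck_on_Suc_imp_Ck_on: "Ck_on (Suc k) V S f \<Longrightarrow> Ck_on k V S f"
proof (induction k arbitrary: f)
  case (Suc k)
  have "continuous_on S f"
    using Suc.prems by simp
  moreover have "\<exists>f'. (\<forall>x\<in>S. ((\<lambda>t. f (x + t *\<^sub>R v)) has_vector_derivative f' x) (at 0)) \<and> Ck_on k V S f'"
    if v: "v \<in> V" for v
    using Ck_on_SucD[OF Suc.prems v] Suc.IH by blast
  ultimately show ?case by simp
qed simp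

lemma Ck_on_const: "Ck_on k V S (\<lambda>x. c)"
proof (induction k arbitrary: c)
  case (Suc k)
  have "\<exists>f'. (\<forall>x\<in>S. ((\<lambda>t. c) has_vector_derivative f' x) (at 0)) \<and> Ck_on k V S f'"
    by (intro exI[of _ "\<lambda>x. 0"] conjI ballI has_vector_derivative_const Suc)
  then show ?case by simp
qed simp

lemma Ck_on_add:
  assumes "Ck_on k V S f" "Ck_on k V S g"
  shows "Ck_on k V S (\<lambda>x. f x + g x)"
  using assms
proof (induction k arbitrary: f g)
  case 0
  then show ?case by (auto intro: continuous_on_add)
next
  case (Suc k)
  have "\<exists>h. (\<forall>x\<in>S. ((\<lambda>t. f (x + t *\<^sub>R v) + g (x + t *\<^sub>R v)) has_vector_derivative h x) (at 0))
          \<and> Ck_on k V S h" if v: "v \<in> V" for v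
  proof -
    obtain f'
      where f': "\<forall>x\<in>S. ((\<lambda>t. f (x + t *\<^sub>R v)) has_vector_derivative f' x) (at 0)" "Ck_on k V S f'"
      using Ck_on_SucD[OF Suc.prems(1) v] by blast
    obtain g'
      where g': "\<forall>x\<in>S. ((\<lambda>t. g (x + t *\<^sub>R v)) has_vector_derivative g' x) (at 0)" "Ck_on k V S g'"
      using Ck_on_SucD[OF Suc.prems(2) v] by blast
    show ?thesis
      using f' g' Suc.IH
      by (intro exI[of _ "\<lambda>x. f' x + g' x"]) (auto intro: has_vector_derivative_add)
  qed
  then show ?case
    using Suc.prems by (simp add: continuous_on_add)
qed

text \<open>
  The directional derivatives of a product are given by the product rule, whose terms again consist of
  factors of class k.
\<close>

lemma Ck_on_mult:
  fixes f g :: "'e::euclidean_space \<Rightarrow> 'b::real_normed_algebra"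
  assumes "Ck_on k V S f" "Ck_on k V S g"
  shows "Ck_on k V S (\<lambda>x. f x * g x)"
  using assms
proof (induction k arbitrary: f g)
  case 0
  then show ?case by (auto intro: continuous_on_mult)
next
  case (Suc k)
  have "\<exists>h. (\<forall>x\<in>S. ((\<lambda>t. f (x + t *\<^sub>R v) * g (x + t *\<^sub>R v)) has_vector_derivative h x) (at 0))
          \<and> Ck_on k V S h" if v: "v \<in> V" for v
  proof -
    obtain f'
      where f': "\<forall>x\<in>S. ((\<lambda>t. f (x + t *\<^sub>R v)) has_vector_derivative f' x) (at 0)" "Ck_on k V S f'"
      using Ck_on_SucD[OF Suc.prems(1) v] by blast
    obtain g'
      where g': "\<forall>x\<in>S. ((\<lambda>t. g (x + t *\<^sub>R v)) has_vector_derivative g' x) (at 0)" "Ck_on k V S g'"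
      using Ck_on_SucD[OF Suc.prems(2) v] by blast
    have "((\<lambda>t. f (x + t *\<^sub>R v) * g (x + t *\<^sub>R v)) has_vector_derivative (f x * g' x + f' x * g x)) (at 0)"
      if "x \<in> S" for x
      using has_vector_derivative_mult[OF f'(1)[rule_format, OF that] g'(1)[rule_format, OF that]]
      by simp
    moreover have "Ck_on k V S (\<lambda>x. f x * g' x + f' x * g x)"
      using f' g' Suc.prems[THEN Ck_on_Suc_imp_Ck_on] by (intro Ck_on_add Suc.IH)
    ultimately show ?thesis
      by (intro exI[of _ "\<lambda>x. f x * g' x + f' x * g x"]) simp
  qed
  then show ?case
    using Suc.prems by (simp add: continuous_on_mult)
qed

lemma smooth_funs_const: "(\<lambda>p. c) \<in> smooth_funs M"
  by (auto simp: smooth_funs_def smooth_on_def o_def Ck_on_const)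

lemma smooth_funs_add: "f \<in> smooth_funs M \<Longrightarrow> g \<in> smooth_funs M \<Longrightarrow> f + g \<in> smooth_funs M"
  by (simp add: smooth_funs_def smooth_on_def o_def split_beta Ck_on_add)

lemma smooth_funs_mult:
  fixes f g :: "'m::topological_space \<Rightarrow> 'b::real_normed_algebra"
  shows "f \<in> smooth_funs M \<Longrightarrow> g \<in> smooth_funs M \<Longrightarrow> f * g \<in> smooth_funs M"
  by (simp add: smooth_funs_def smooth_on_def o_def split_beta Ck_on_mult)

lemma smooth_funs_zero: "0 \<in> smooth_funs M"
  using smooth_funs_const[of 0] by (simp add: zero_fun_def)

lemma smooth_funs_cmult:
  fixes f :: "'m::topological_space \<Rightarrow> complex"
  assumes "f \<in> smooth_funs M"
  shows "(\<lambda>p. c * f p) \<in> smooth_funs M"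
  using smooth_funs_mult[OF smooth_funs_const assms, of c] by (simp add: times_fun_def)

lemma derivation_add:
  "X \<in> vector_fields M \<Longrightarrow> f \<in> smooth_funs M \<Longrightarrow> g \<in> smooth_funs M \<Longrightarrow> X (f + g) = X f + X g"
  unfolding vector_fields_def by blast

lemma derivation_mult:
  "X \<in> vector_fields M \<Longrightarrow> f \<in> smooth_funs M \<Longrightarrow> g \<in> smooth_funs M \<Longrightarrow> X (f * g) = X f * g + f * X g"
  unfolding vector_fields_def by blast

lemma derivation_cmult:
  "X \<in> vector_fields M \<Longrightarrow> f \<in> smooth_funs M \<Longrightarrow> X (\<lambda>p. c * f p) = (\<lambda>p. c * X f p)"
  unfolding vector_fields_def by blast

text \<open>
  The product rule for \<open>1 \<cdot> 1\<close> forces a derivation to annihilate 1.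
\<close>

lemma derivation_const:
  assumes "X \<in> vector_fields M"
  shows "X (\<lambda>p. c) = 0"
proof -
  have "X (\<lambda>p. 1) = X ((\<lambda>p. 1) * (\<lambda>p. 1))"
    by (simp add: times_fun_def)
  also have "\<dots> = X (\<lambda>p. 1) * (\<lambda>p. 1) + (\<lambda>p. 1) * X (\<lambda>p. 1)"
    by (rule derivation_mult[OF assms smooth_funs_const smooth_funs_const])
  finally have "X (\<lambda>p. 1) = 0"
    by (simp add: times_fun_def plus_fun_def zero_fun_def fun_eq_iff)
  then show ?thesis
    using derivation_cmult[OF assms smooth_funs_const, of c 1] by (simp add: zero_fun_def)
qed

lemma derivation_zero: "X \<in> vector_fields M \<Longrightarrow> X 0 = 0"
  using derivation_const[of X M 0] by (simp add: zero_fun_def)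

text \<open>
  The term of degree k of the exponential series.
\<close>

definition exp_coeff :: "('m \<Rightarrow> complex) \<Rightarrow> nat \<Rightarrow> 'm \<Rightarrow> complex" where
  "exp_coeff a k = (\<lambda>p. a p ^ k / fact k)"

lemma exp_coeff_0: "exp_coeff a 0 = (\<lambda>p. 1)"
  by (simp add: exp_coeff_def)

lemma exp_coeff_Suc: "exp_coeff a (Suc k) = (\<lambda>p. 1 / of_nat (Suc k) * (a * exp_coeff a k) p)"
  by (simp add: exp_coeff_def fun_eq_iff field_simps)

lemma exp_coeff_smooth: "a \<in> smooth_funs M \<Longrightarrow> exp_coeff a k \<in> smooth_funs M"
proof (induction k)
  case (Suc k)
  then show ?case
    unfolding exp_coeff_Suc by (intro smooth_funs_cmult smooth_funs_mult)
qed (simp add: exp_coeff_0 smooth_funs_const)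

text \<open>
  The chain rule \<open>X (exp a) = exp a \<cdot> X a\<close>, degree by degree. The induction uses
  \<open>(k + 1) e\<^sub>k\<^sub>+\<^sub>1 = a e\<^sub>k\<close> for the terms \<open>e\<^sub>k\<close> of the series.
\<close>

lemma derivation_exp_coeff:
  assumes X: "X \<in> vector_fields M" and a: "a \<in> smooth_funs M"
  shows "X (exp_coeff a (Suc k)) = exp_coeff a k * X a"
proof (induction k)
  case 0
  show ?case by (simp add: exp_coeff_def times_fun_def)
next
  case (Suc k)
  have "X (exp_coeff a (Suc (Suc k))) =
      (\<lambda>p. 1 / of_nat (Suc (Suc k)) * (X a * exp_coeff a (Suc k) + a * X (exp_coeff a (Suc k))) p)"
    unfolding exp_coeff_Suc[of a "Suc k"]
    by (subst derivation_cmult[OF X]) (use assms in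
      \<open>auto simp: smooth_funs_mult exp_coeff_smooth derivation_mult[OF X] simp del: times_fun_apply\<close>)
  also have "X a * exp_coeff a (Suc k) + a * X (exp_coeff a (Suc k)) =
      (\<lambda>p. of_nat (Suc (Suc k)) * (exp_coeff a (Suc k) * X a) p)"
  proof
    fix p
    have "a p * exp_coeff a k p = of_nat (Suc k) * exp_coeff a (Suc k) p"
      by (simp add: exp_coeff_def del: of_nat_Suc)
    then have "X a p * (a p * exp_coeff a k p) = X a p * (of_nat (Suc k) * exp_coeff a (Suc k) p)"
      by simp
    then show "(X a * exp_coeff a (Suc k) + a * X (exp_coeff a (Suc k))) p =
        of_nat (Suc (Suc k)) * (exp_coeff a (Suc k) * X a) p"
      unfolding Suc by (simp add: algebra_simps)
  qed
  also have "(\<lambda>p. 1 / of_nat (Suc (Suc k)) * (of_nat (Suc (Suc k)) * (exp_coeff a (Suc k) * X a) p)) =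
      exp_coeff a (Suc k) * X a"
    by (simp del: of_nat_Suc times_fun_apply)
  finally show ?case .
qed


section \<open>Forms as a module over the smooth functions\<close>

definition form_mult :: "('m \<Rightarrow> complex) \<Rightarrow> 'm form \<Rightarrow> 'm form" where
  "form_mult h \<omega> = (\<lambda>Xs. h * \<omega> Xs)"

lemma nths_eq_Nil_iff: "nths xs I = [] \<longleftrightarrow> (\<forall>i\<in>I. length xs \<le> i)"
proof -
  have "nths xs I = [] \<longleftrightarrow> {i. i < length xs \<and> i \<in> I} = {}"
    by (simp add: length_nths flip: length_0_conv)
  also have "\<dots> \<longleftrightarrow> (\<forall>i\<in>I. length xs \<le> i)"
    by (auto simp: not_le[symmetric])
  finally show ?thesis .
qed

text \<open>
  A function only accepts the empty list of arguments, so the empty set is the only splitting that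
  contributes.
\<close>

lemma wedge_fun_form: "wedge (fun_form h) \<omega> = form_mult h \<omega>"
proof
  fix Xs
  have "wedge (fun_form h) \<omega> Xs = (\<Sum>S\<in>{{}}. shuffle_sign (length Xs) S *
          fun_form h (nths Xs S) * \<omega> (nths Xs (- S)))"
    unfolding wedge_def
    by (rule sum.mono_neutral_right) (fastforce simp: fun_form_def nths_eq_Nil_iff)+
  also have "\<dots> = h * \<omega> Xs"
    by (simp add: shuffle_sign_def fun_form_def nths_all times_fun_def)
  finally show "wedge (fun_form h) \<omega> Xs = form_mult h \<omega> Xs"
    by (simp add: form_mult_def)
qed

lemma wedge_add_right: "wedge \<omega> (\<eta> + \<zeta>) = wedge \<omega> \<eta> + wedge \<omega> \<zeta>"
  by (intro ext) (simp add: wedge_def algebra_simps sum.distrib)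

lemma wedge_add_left: "wedge (\<eta> + \<zeta>) \<omega> = wedge \<eta> \<omega> + wedge \<zeta> \<omega>"
  by (intro ext) (simp add: wedge_def algebra_simps sum.distrib)

lemma wedge_zero_right: "wedge \<omega> 0 = 0"
  by (intro ext) (simp add: wedge_def)

lemma wedge_zero_left: "wedge 0 \<omega> = 0"
  by (intro ext) (simp add: wedge_def)

lemma wedge_sum_right: "wedge \<omega> (\<Sum>k\<in>A. F k) = (\<Sum>k\<in>A. wedge \<omega> (F k))"
  by (induction A rule: infinite_finite_induct)
    (simp_all only: sum.infinite sum.empty sum.insert not_False_eq_True wedge_zero_right wedge_add_right)

lemma wedge_form_mult_right: "wedge \<omega> (form_mult h \<eta>) = form_mult h (wedge \<omega> \<eta>)"
  by (intro ext) (simp add: wedge_def form_mult_def sum_distrib_left mult_ac)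

lemma wedge_form_mult_left: "wedge (form_mult h \<omega>) \<eta> = form_mult h (wedge \<omega> \<eta>)"
  by (intro ext) (simp add: wedge_def form_mult_def sum_distrib_left mult_ac)

lemma form_scale_eq_form_mult: "form_scale c \<omega> = form_mult (\<lambda>p. c) \<omega>"
  by (simp add: form_scale_def form_mult_def times_fun_def)

lemma form_mult_add_right: "form_mult h (\<omega> + \<eta>) = form_mult h \<omega> + form_mult h \<eta>"
  by (intro ext) (simp add: form_mult_def algebra_simps)

lemma form_mult_diff_right: "form_mult h (\<omega> - \<eta>) = form_mult h \<omega> - form_mult h \<eta>"
  by (intro ext) (simp add: form_mult_def algebra_simps)

lemma form_mult_zero_right: "form_mult h 0 = 0"
  by (intro ext) (simp add: form_mult_def)

lemma form_mult_sum_right: "form_mult h (\<Sum>k\<in>A. F k) = (\<Sum>k\<in>A. form_mult h (F k))"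
  by (induction A rule: infinite_finite_induct)
    (simp_all only: sum.infinite sum.empty sum.insert not_False_eq_True form_mult_zero_right form_mult_add_right)

lemma form_mult_form_mult: "form_mult f (form_mult g \<omega>) = form_mult (f * g) \<omega>"
  by (simp add: form_mult_def mult.assoc)

lemma form_mult_one: "form_mult (\<lambda>p. 1) \<omega> = \<omega>"
  by (simp add: form_mult_def times_fun_def)

lemma interior_add: "interior X (\<omega> + \<eta>) = interior X \<omega> + interior X \<eta>"
  by (intro ext) (simp add: interior_def)

lemma interior_zero: "interior X 0 = 0"
  by (intro ext) (simp add: interior_def)

lemma interior_sum: "interior X (\<Sum>k\<in>A. F k) = (\<Sum>k\<in>A. interior X (F k))"
  by (induction A rule: infinite_finite_induct)
    (simp_all only: sum.infinite sum.empty sum.insert not_False_eq_True interior_zero interior_add)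

lemma interior_form_mult: "interior X (form_mult h \<omega>) = form_mult h (interior X \<omega>)"
  by (intro ext) (simp add: interior_def form_mult_def)

lemma forms_smooth: "\<omega> \<in> forms M \<Longrightarrow> \<omega> Xs \<in> smooth_funs M"
  unfolding forms_def using smooth_funs_zero by (cases "set Xs \<subseteq> vector_fields M") auto

lemma forms_outside: "\<omega> \<in> forms M \<Longrightarrow> \<not> set Xs \<subseteq> vector_fields M \<Longrightarrow> \<omega> Xs = 0"
  unfolding forms_def by blast

lemma forms_zero: "0 \<in> forms M"
  by (simp add: forms_def smooth_funs_zero)

lemma forms_add: "\<omega> \<in> forms M \<Longrightarrow> \<eta> \<in> forms M \<Longrightarrow> \<omega> + \<eta> \<in> forms M"
  by (simp add: forms_def smooth_funs_add algebra_simps)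

lemma forms_sum: "(\<And>k. k \<in> A \<Longrightarrow> F k \<in> forms M) \<Longrightarrow> (\<Sum>k\<in>A. F k) \<in> forms M"
  by (induction A rule: infinite_finite_induct) (auto simp: forms_zero forms_add)

lemma forms_form_mult: "h \<in> smooth_funs M \<Longrightarrow> \<omega> \<in> forms M \<Longrightarrow> form_mult h \<omega> \<in> forms M"
  by (simp add: forms_def form_mult_def smooth_funs_mult algebra_simps)


section \<open>The Leibniz rule for the exterior derivative\<close>

lemma ext_d_add:
  assumes "\<omega> \<in> forms M" "\<eta> \<in> forms M"
  shows "ext_d M (\<omega> + \<eta>) = ext_d M \<omega> + ext_d M \<eta>"
proof
  fix Xs :: "'a vfield list"
  show "ext_d M (\<omega> + \<eta>) Xs = (ext_d M \<omega> + ext_d M \<eta>) Xs"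
  proof (cases "set Xs \<subseteq> vector_fields M")
    case True
    have "(Xs ! i) (\<omega> Ys + \<eta> Ys) = (Xs ! i) (\<omega> Ys) + (Xs ! i) (\<eta> Ys)" if "i < length Xs" for i Ys
      using that True assms by (intro derivation_add) (auto simp: forms_smooth)
    then show ?thesis
      using True by (simp add: ext_d_def distrib_left sum.distrib algebra_simps)
  qed (simp add: ext_d_def)
qed

lemma ext_d_zero: "ext_d M 0 = 0"
proof
  fix Xs :: "'a vfield list"
  have "(Xs ! i) 0 = 0" if "set Xs \<subseteq> vector_fields M" "i < length Xs" for i
    using that by (intro derivation_zero) auto
  then show "ext_d M 0 Xs = 0 Xs"
    by (simp add: ext_d_def)
qed

lemma ext_d_sum:
  "(\<And>k. k \<in> A \<Longrightarrow> F k \<in> forms M) \<Longrightarrow> ext_d M (\<Sum>k\<in>A. F k) = (\<Sum>k\<in>A. ext_d M (F k))"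
  by (induction A rule: infinite_finite_induct) (auto simp: ext_d_zero ext_d_add forms_sum)

text \<open>
  This is the differential \<open>dh(X) = X h\<close>. On longer lists every term of the formula evaluates
  the function on a nonempty list, which gives 0.
\<close>

lemma ext_d_fun_form:
  "ext_d M (fun_form h) Xs =
     (if length Xs = 1 \<and> set Xs \<subseteq> vector_fields M then hd Xs h else 0)"
proof (cases "set Xs \<subseteq> vector_fields M")
  case vf: True
  show ?thesis
  proof (cases "length Xs = 1")
    case True
    then obtain X where "Xs = [X]" by (auto simp: length_Suc_conv)
    then show ?thesis using vf by (simp add: ext_d_def fun_form_def)
  next
    case False
    have "(Xs ! i) (fun_form h (nths Xs (- {i}))) = 0" if "i < length Xs" for i
    proof -
      have "nths Xs (- {i}) \<noteq> []"
      proof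
        assume "nths Xs (- {i}) = []"
        then have "{..<length Xs} \<subseteq> {i}"
          unfolding nths_eq_Nil_iff by (meson ComplI lessThan_iff not_le subsetI)
        then have "length Xs \<le> 1" using card_mono[of "{i}" "{..<length Xs}"] by simp
        then show False using False that by simp
      qed
      moreover have "Xs ! i \<in> vector_fields M"
        using that vf by auto
      ultimately show ?thesis
        by (simp only: fun_form_def if_False derivation_zero)
    qed
    moreover have "fun_form h (Y # Ys) = 0" for Y Ys by (simp add: fun_form_def)
    ultimately show ?thesis using False by (simp add: ext_d_def)
  qed
qed (auto simp: ext_d_def)

lemma nths_singleton_position: "i < length xs \<Longrightarrow> nths xs {i} = [xs ! i]"
proof -
  assume i: "i < length xs"
  then have "{j. j < length xs \<and> j \<in> {i}} = {i}" by auto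
  then have "length (nths xs {i}) = 1" unfolding length_nths by simp
  then obtain y where y: "nths xs {i} = [y]" by (auto simp: length_Suc_conv)
  moreover have "set (nths xs {i}) = {xs ! i}" using i by (auto simp: set_nths)
  ultimately show ?thesis by simp
qed

lemma shuffle_sign_singleton:
  assumes "i < n"
  shows "shuffle_sign n {i} = (-1) ^ i"
proof -
  have "{(i', j). i' \<in> {i} \<and> j \<in> {..<n} - {i} \<and> j < i'} = {i} \<times> {..<i}"
    using assms by auto
  then have "shuffle_sign n {i} = (\<lambda>_. (-1) ^ i)"
    unfolding shuffle_sign_def by (simp add: card_cartesian_product)
  moreover have "((-1) ^ k :: 'a \<Rightarrow> complex) = (\<lambda>_. (-1) ^ k)" for k
    by (induction k) (auto simp: fun_eq_iff)
  ultimately show ?thesis by simp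
qed

text \<open>
  As \<open>dh\<close> is a one-form, only the splittings with a single position in the first part contribute;
  moving position i to the front costs the sign \<open>(-1)\<^sup>i\<close>. The result is the sum that the
  product rule leaves over when \<open>ext_d\<close> is applied to a multiple of \<open>\<omega>\<close>.
\<close>

lemma wedge_ext_d_fun_form:
  assumes "set Xs \<subseteq> vector_fields M"
  shows "wedge (ext_d M (fun_form h)) \<omega> Xs =
           (\<Sum>i<length Xs. (-1) ^ i * (Xs ! i) h * \<omega> (nths Xs (- {i})))"
proof -
  let ?t = "\<lambda>S. shuffle_sign (length Xs) S * ext_d M (fun_form h) (nths Xs S) * \<omega> (nths Xs (- S))"
  have "?t S = 0" if "S \<in> Pow {..<length Xs} - (\<lambda>i. {i}) ` {..<length Xs}" for S
  proof -
    have "{i. i < length Xs \<and> i \<in> S} = S" using that by auto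
    moreover have "card S \<noteq> 1" using that by (auto simp: card_1_singleton_iff)
    ultimately have "length (nths Xs S) \<noteq> 1" by (simp add: length_nths)
    then show ?thesis by (simp add: ext_d_fun_form)
  qed
  then have "wedge (ext_d M (fun_form h)) \<omega> Xs = (\<Sum>S\<in>(\<lambda>i. {i}) ` {..<length Xs}. ?t S)"
    unfolding wedge_def by (intro sum.mono_neutral_right) auto
  also have "\<dots> = (\<Sum>i<length Xs. ?t {i})"
    by (subst sum.reindex) (auto simp: inj_on_def)
  also have "\<dots> = (\<Sum>i<length Xs. (-1) ^ i * (Xs ! i) h * \<omega> (nths Xs (- {i})))"
    using assms by (intro sum.cong)
      (auto simp: shuffle_sign_singleton nths_singleton_position ext_d_fun_form subset_iff)
  finally show ?thesis .
qed

text \<open>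
  An argument that is not a vector field lands in one of the two parts of every splitting, and both factors
  vanish on such arguments.
\<close>

lemma wedge_ext_d_outside:
  assumes "\<omega> \<in> forms M" "\<not> set Xs \<subseteq> vector_fields M"
  shows "wedge (ext_d M \<eta>) \<omega> Xs = 0"
proof -
  have "ext_d M \<eta> (nths Xs S) = 0 \<or> \<omega> (nths Xs (- S)) = 0" for S
  proof (cases "set (nths Xs S) \<subseteq> vector_fields M")
    case True
    then have "\<not> set (nths Xs (- S)) \<subseteq> vector_fields M"
      using assms(2) by (fastforce simp: set_nths in_set_conv_nth)
    then show ?thesis using forms_outside[OF assms(1)] by blast
  qed (simp add: ext_d_def)
  then have "shuffle_sign (length Xs) S * ext_d M \<eta> (nths Xs S) * \<omega> (nths Xs (- S)) = 0" for S
    by (metis mult_zero_left mult_zero_right)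
  then show ?thesis by (simp only: wedge_def sum.neutral_const)
qed

text \<open>
  The bracket terms in \<open>ext_d\<close> do not differentiate the coefficient, so h factors out of them. The
  product rule splits every other term in two; the parts with \<open>X\<^sub>i h\<close> add up to the wedge
  product with \<open>dh\<close>.
\<close>

lemma ext_d_form_mult:
  assumes h: "h \<in> smooth_funs M" and \<omega>: "\<omega> \<in> forms M"
  shows "ext_d M (form_mult h \<omega>) = wedge (ext_d M (fun_form h)) \<omega> + form_mult h (ext_d M \<omega>)"
proof
  fix Xs :: "'a vfield list"
  show "ext_d M (form_mult h \<omega>) Xs = (wedge (ext_d M (fun_form h)) \<omega> + form_mult h (ext_d M \<omega>)) Xs"
  proof (cases "set Xs \<subseteq> vector_fields M")
    case True
    have "(Xs ! i) (h * \<omega> Ys) = (Xs ! i) h * \<omega> Ys + h * (Xs ! i) (\<omega> Ys)" if "i < length Xs" for i Ys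
      using that True assms by (intro derivation_mult) (auto simp: forms_smooth)
    then have "ext_d M (form_mult h \<omega>) Xs =
        (\<Sum>i<length Xs. (-1) ^ i * (Xs ! i) h * \<omega> (nths Xs (- {i}))) + h * ext_d M \<omega> Xs"
      using True
      by (simp add: ext_d_def form_mult_def sum_distrib_left sum.distrib algebra_simps)
    then show ?thesis
      using True by (simp add: wedge_ext_d_fun_form form_mult_def)
  qed (use \<omega> in \<open>simp add: wedge_ext_d_outside, simp add: ext_d_def form_mult_def\<close>)
qed

lemma ext_d_exp_coeff:
  assumes "a \<in> smooth_funs M"
  shows "ext_d M (fun_form (exp_coeff a (Suc k))) = form_mult (exp_coeff a k) (ext_d M (fun_form a))"
proof
  fix Xs :: "'a vfield list"
  show "ext_d M (fun_form (exp_coeff a (Suc k))) Xs = form_mult (exp_coeff a k) (ext_d M (fun_form a)) Xs"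
    using derivation_exp_coeff[OF _ assms, of "hd Xs" k]
    by (cases Xs) (auto simp: ext_d_fun_form form_mult_def)
qed

lemma ext_d_fun_form_const: "ext_d M (fun_form (\<lambda>p. c)) = 0"
proof
  fix Xs :: "'a vfield list"
  show "ext_d M (fun_form (\<lambda>p. c)) Xs = 0 Xs"
    by (cases Xs) (auto simp: ext_d_fun_form derivation_const)
qed

lemma ext_d_fun_form_cmult:
  assumes "f \<in> smooth_funs M"
  shows "ext_d M (fun_form (\<lambda>p. c * f p)) = form_scale c (ext_d M (fun_form f))"
proof
  fix Xs :: "'a vfield list"
  show "ext_d M (fun_form (\<lambda>p. c * f p)) Xs = form_scale c (ext_d M (fun_form f)) Xs"
    by (cases Xs) (auto simp: ext_d_fun_form derivation_cmult[OF _ assms] form_scale_def zero_fun_def)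
qed


section \<open>The exponential acting on power series of forms\<close>

text \<open>
  Multiplication by \<open>exp a\<close> in a graded setting: a sequence of forms is the sequence of homogeneous
  components of a power series, a has degree one, and only the components whose degrees add up to n
  contribute.
\<close>

definition exp_mult :: "('m \<Rightarrow> complex) \<Rightarrow> (nat \<Rightarrow> 'm form) \<Rightarrow> nat \<Rightarrow> 'm form" where
  "exp_mult a w n = (\<Sum>k\<le>n. form_mult (exp_coeff a k) (w (n - k)))"

lemma exp_mult_add: "exp_mult a (\<lambda>n. v n + w n) n = exp_mult a v n + exp_mult a w n"
  by (simp only: exp_mult_def form_mult_add_right sum.distrib)

lemma exp_mult_diff: "exp_mult a (\<lambda>n. v n - w n) n = exp_mult a v n - exp_mult a w n"
  by (simp only: exp_mult_def form_mult_diff_right sum_subtractf)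

lemma exp_mult_zero: "exp_mult a (\<lambda>n. 0) n = 0"
  by (simp only: exp_mult_def form_mult_zero_right sum.neutral_const)

lemma exp_mult_wedge: "exp_mult a (\<lambda>n. wedge \<omega> (w n)) n = wedge \<omega> (exp_mult a w n)"
  by (simp only: exp_mult_def wedge_sum_right wedge_form_mult_right)

lemma exp_mult_interior: "exp_mult a (\<lambda>n. interior X (w n)) n = interior X (exp_mult a w n)"
  by (simp only: exp_mult_def interior_sum interior_form_mult)

text \<open>
  The map \<open>case_nat 0\<close> raises the degree by one, as do contraction with the fundamental vector
  field and multiplication with one-forms that are linear in \<open>\<xi>\<close>. It commutes with the exponential.
\<close>

lemma exp_mult_shift: "exp_mult a (case_nat 0 w) n = case_nat 0 (exp_mult a w) n"
proof (cases n)
  case (Suc m)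
  have "(\<Sum>k\<le>m. form_mult (exp_coeff a k) (case_nat 0 w (Suc m - k))) =
      (\<Sum>k\<le>m. form_mult (exp_coeff a k) (w (m - k)))"
    by (intro sum.cong refl) (simp add: Suc_diff_le)
  then have "exp_mult a (case_nat 0 w) (Suc m) =
      (\<Sum>k\<le>m. form_mult (exp_coeff a k) (w (m - k))) + form_mult (exp_coeff a (Suc m)) 0"
    by (simp only: exp_mult_def sum.atMost_Suc diff_self_eq_0 nat.case)
  then show ?thesis
    by (simp only: Suc nat.case exp_mult_def form_mult_zero_right add_0_right)
qed (simp only: exp_mult_def atMost_0 sum.insert finite.emptyI empty_iff not_False_eq_True
      sum.empty diff_self_eq_0 nat.case form_mult_zero_right add_0_right)

text \<open>
  After evaluation at arguments and a point, \<open>exp_mult\<close> is the product with the formal power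
  series of the exponential function, for which the claim is \<open>exp (- a) \<cdot> exp a = 1\<close>.
\<close>

lemma exp_mult_inverse: "exp_mult (- a) (exp_mult a w) = w"
proof (intro ext)
  fix n and Xs :: "'a vfield list" and p
  have eval: "exp_mult b v m Xs p = fps_nth (fps_exp (b p) * Abs_fps (\<lambda>k. v k Xs p)) m" for b v m
  proof -
    have "sum F A Xs p = (\<Sum>k\<in>A. F k Xs p)" for A and F :: "nat \<Rightarrow> 'a form"
      by (induction A rule: infinite_finite_induct) simp_all
    then show ?thesis
      by (simp add: exp_mult_def form_mult_def exp_coeff_def fps_mult_nth atLeast0AtMost)
  qed
  have "exp_mult (- a) (exp_mult a w) n Xs p =
      fps_nth (fps_exp (- a p) * (fps_exp (a p) * Abs_fps (\<lambda>k. w k Xs p))) n"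
    by (simp add: eval fps_nth_inverse)
  also have "fps_exp (- a p) * (fps_exp (a p) * Abs_fps (\<lambda>k. w k Xs p)) = Abs_fps (\<lambda>k. w k Xs p)"
    by (simp flip: mult.assoc fps_exp_add_mult)
  finally show "exp_mult (- a) (exp_mult a w) n Xs p = w n Xs p"
    by (simp only: fps_nth_Abs_fps)
qed

text \<open>
  The formula \<open>d (exp a \<cdot> w) = exp a \<cdot> dw + da \<and> (exp a \<cdot> w)\<close>. Differentiating the
  term of degree \<open>k + 1\<close> of the exponential yields the term of degree k times \<open>da\<close>, whence
  the shift in the second summand.
\<close>

lemma ext_d_exp_mult:
  assumes a: "a \<in> smooth_funs M" and w: "\<And>n. w n \<in> forms M"
  shows "ext_d M (exp_mult a w n) = exp_mult a (\<lambda>n. ext_d M (w n)) n +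
           case_nat 0 (\<lambda>m. wedge (ext_d M (fun_form a)) (exp_mult a w m)) n"
proof -
  let ?e = "exp_coeff a"
  let ?da = "ext_d M (fun_form a)"
  have "ext_d M (exp_mult a w n) = (\<Sum>k\<le>n. ext_d M (form_mult (?e k) (w (n - k))))"
    unfolding exp_mult_def by (intro ext_d_sum forms_form_mult exp_coeff_smooth a w)
  also have "\<dots> = (\<Sum>k\<le>n. wedge (ext_d M (fun_form (?e k))) (w (n - k)) +
      form_mult (?e k) (ext_d M (w (n - k))))"
    by (intro sum.cong refl ext_d_form_mult exp_coeff_smooth a w)
  also have "\<dots> = (\<Sum>k\<le>n. wedge (ext_d M (fun_form (?e k))) (w (n - k))) +
      exp_mult a (\<lambda>n. ext_d M (w n)) n"
    by (simp only: sum.distrib exp_mult_def)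
  also have "(\<Sum>k\<le>n. wedge (ext_d M (fun_form (?e k))) (w (n - k))) =
      case_nat 0 (\<lambda>m. wedge ?da (exp_mult a w m)) n"
  proof (cases n)
    case 0
    then show ?thesis by (simp add: exp_coeff_0 ext_d_fun_form_const wedge_zero_left)
  next
    case (Suc m)
    have "(\<Sum>k\<le>Suc m. wedge (ext_d M (fun_form (?e k))) (w (Suc m - k))) =
        (\<Sum>k\<le>m. wedge (form_mult (?e k) ?da) (w (m - k)))"
      by (simp only: sum.atMost_Suc_shift exp_coeff_0 ext_d_fun_form_const wedge_zero_left
          ext_d_exp_coeff[OF a] diff_Suc_Suc add_0_left)
    then show ?thesis
      by (simp only: Suc nat.case wedge_form_mult_left exp_mult_def wedge_sum_right wedge_form_mult_right)
  qed
  finally show ?thesis by (simp only: add.commute)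
qed


section \<open>Homogeneous polynomials with values in forms\<close>

text \<open>
  The polarisation that witnesses that a map is a homogeneous polynomial.
\<close>

definition multilinear_map ::
  "('g::topological_space, 'f::euclidean_space) manifold \<Rightarrow> 'g monoid \<Rightarrow>
   ('m::topological_space, 'e::euclidean_space) manifold \<Rightarrow> nat \<Rightarrow> ('g lie list \<Rightarrow> 'm form) \<Rightarrow> bool" where
  "multilinear_map N G M k B \<longleftrightarrow>
     (\<forall>\<xi>s. set \<xi>s \<subseteq> lie_algebra N G \<and> length \<xi>s = k \<longrightarrow> B \<xi>s \<in> forms M) \<and>
     (\<forall>\<xi>s \<eta>s. \<forall>\<xi>\<in>lie_algebra N G. \<forall>\<eta>\<in>lie_algebra N G.
        set \<xi>s \<subseteq> lie_algebra N G \<and> set \<eta>s \<subseteq> lie_algebra N G \<and> length \<xi>s + length \<eta>s + 1 = k \<longrightarrow>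
        B (\<xi>s @ (\<xi> + \<eta>) # \<eta>s) = B (\<xi>s @ \<xi> # \<eta>s) + B (\<xi>s @ \<eta> # \<eta>s)) \<and>
     (\<forall>\<xi>s \<eta>s c. \<forall>\<xi>\<in>lie_algebra N G.
        set \<xi>s \<subseteq> lie_algebra N G \<and> set \<eta>s \<subseteq> lie_algebra N G \<and> length \<xi>s + length \<eta>s + 1 = k \<longrightarrow>
        B (\<xi>s @ lie_scale c \<xi> # \<eta>s) = form_scale (of_real c) (B (\<xi>s @ \<xi> # \<eta>s)))"

lemma homogeneous_poly_iff_multilinear_map:
  "homogeneous_poly N G M k P \<longleftrightarrow>
     (\<exists>B. multilinear_map N G M k B \<and> (\<forall>\<xi>\<in>lie_algebra N G. P \<xi> = B (replicate k \<xi>))) \<and>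
     (\<forall>\<xi>. \<xi> \<notin> lie_algebra N G \<longrightarrow> P \<xi> = 0)"
  unfolding homogeneous_poly_def multilinear_map_def by (simp only: conj_assoc)

lemma homogeneous_poly_outside: "homogeneous_poly N G M k P \<Longrightarrow> \<xi> \<notin> lie_algebra N G \<Longrightarrow> P \<xi> = 0"
  unfolding homogeneous_poly_def by blast

lemma homogeneous_poly_forms:
  assumes "homogeneous_poly N G M k P"
  shows "P \<xi> \<in> forms M"
proof (cases "\<xi> \<in> lie_algebra N G")
  case True
  obtain B where "multilinear_map N G M k B" "P \<xi> = B (replicate k \<xi>)"
    using assms True unfolding homogeneous_poly_iff_multilinear_map by blast
  moreover have "set (replicate k \<xi>) \<subseteq> lie_algebra N G"
    using True by auto
  ultimately show ?thesis
    unfolding multilinear_map_def by (metis length_replicate)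
next
  case False
  then show ?thesis
    by (metis homogeneous_poly_outside[OF assms] forms_zero)
qed

lemma homogeneous_poly_zero: "homogeneous_poly N G M k (\<lambda>\<xi>. 0)"
proof -
  have "multilinear_map N G M k (\<lambda>\<xi>s. 0)"
    unfolding multilinear_map_def
    by (simp only: forms_zero form_scale_eq_form_mult form_mult_zero_right add_0_left) simp
  then show ?thesis
    unfolding homogeneous_poly_iff_multilinear_map by blast
qed

lemma homogeneous_poly_add:
  assumes "homogeneous_poly N G M k P" "homogeneous_poly N G M k Q"
  shows "homogeneous_poly N G M k (\<lambda>\<xi>. P \<xi> + Q \<xi>)"
proof -
  obtain B where B: "multilinear_map N G M k B" "\<forall>\<xi>\<in>lie_algebra N G. P \<xi> = B (replicate k \<xi>)"
    using assms(1) unfolding homogeneous_poly_iff_multilinear_map by blast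
  obtain C where C: "multilinear_map N G M k C" "\<forall>\<xi>\<in>lie_algebra N G. Q \<xi> = C (replicate k \<xi>)"
    using assms(2) unfolding homogeneous_poly_iff_multilinear_map by blast
  have "multilinear_map N G M k (\<lambda>\<xi>s. B \<xi>s + C \<xi>s)"
    using B(1) C(1) unfolding multilinear_map_def
    by (simp add: forms_add form_scale_eq_form_mult form_mult_add_right add_ac)
  then have "\<exists>B'. multilinear_map N G M k B' \<and>
      (\<forall>\<xi>\<in>lie_algebra N G. P \<xi> + Q \<xi> = B' (replicate k \<xi>))"
    using B(2) C(2) by (intro exI[of _ "\<lambda>\<xi>s. B \<xi>s + C \<xi>s"]) metis
  moreover have "P \<xi> + Q \<xi> = 0" if "\<xi> \<notin> lie_algebra N G" for \<xi>
    using assms that by (metis homogeneous_poly_outside add_0_left)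
  ultimately show ?thesis
    unfolding homogeneous_poly_iff_multilinear_map by blast
qed

lemma homogeneous_poly_sum:
  "(\<And>i. i \<in> A \<Longrightarrow> homogeneous_poly N G M k (P i)) \<Longrightarrow> homogeneous_poly N G M k (\<lambda>\<xi>. \<Sum>i\<in>A. P i \<xi>)"
  by (induction A rule: infinite_finite_induct)
    (simp_all only: sum.infinite sum.empty sum.insert not_False_eq_True
      homogeneous_poly_zero homogeneous_poly_add insert_iff simp_thms)

lemma homogeneous_poly_form_mult:
  assumes P: "homogeneous_poly N G M k P" and h: "h \<in> smooth_funs M"
  shows "homogeneous_poly N G M k (\<lambda>\<xi>. form_mult h (P \<xi>))"
proof -
  obtain B where B: "multilinear_map N G M k B" "\<forall>\<xi>\<in>lie_algebra N G. P \<xi> = B (replicate k \<xi>)"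
    using P unfolding homogeneous_poly_iff_multilinear_map by blast
  have "multilinear_map N G M k (\<lambda>\<xi>s. form_mult h (B \<xi>s))"
    using B(1) h unfolding multilinear_map_def
    by (simp add: forms_form_mult form_scale_eq_form_mult form_mult_add_right form_mult_form_mult mult.commute)
  then have "\<exists>B'. multilinear_map N G M k B' \<and>
      (\<forall>\<xi>\<in>lie_algebra N G. form_mult h (P \<xi>) = B' (replicate k \<xi>))"
    using B(2) by (intro exI[of _ "\<lambda>\<xi>s. form_mult h (B \<xi>s)"]) metis
  moreover have "form_mult h (P \<xi>) = 0" if "\<xi> \<notin> lie_algebra N G" for \<xi>
    using P that by (metis homogeneous_poly_outside form_mult_zero_right)
  ultimately show ?thesis
    unfolding homogeneous_poly_iff_multilinear_map by blast
qed

text \<open>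
  The product of a linear function and a homogeneous polynomial of degree k is polarised by letting the
  first argument go to the linear function and the others to the polarisation of the polynomial. No
  symmetrisation is needed, since homogeneous polynomials are the restrictions of arbitrary multilinear maps.
\<close>

lemma homogeneous_poly_linear_mult:
  assumes P: "homogeneous_poly N G M k P"
    and smooth: "\<And>\<xi>. \<xi> \<in> lie_algebra N G \<Longrightarrow> l \<xi> \<in> smooth_funs M"
    and add: "\<And>\<xi> \<eta>. \<xi> \<in> lie_algebra N G \<Longrightarrow> \<eta> \<in> lie_algebra N G \<Longrightarrow> l (\<xi> + \<eta>) = l \<xi> + l \<eta>"
    and scale: "\<And>c \<xi>. \<xi> \<in> lie_algebra N G \<Longrightarrow> l (lie_scale c \<xi>) = (\<lambda>p. of_real c * l \<xi> p)"
  shows "homogeneous_poly N G M (Suc k) (\<lambda>\<xi>. form_mult (l \<xi>) (P \<xi>))"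
proof -
  let ?L = "lie_algebra N G"
  obtain B where B: "multilinear_map N G M k B" and PB: "\<forall>\<xi>\<in>?L. P \<xi> = B (replicate k \<xi>)"
    using P unfolding homogeneous_poly_iff_multilinear_map by blast
  define C where "C = (\<lambda>\<xi>s. form_mult (l (hd \<xi>s)) (B (tl \<xi>s)))"
  have C_Cons: "C (\<xi> # \<xi>s) = form_mult (l \<xi>) (B \<xi>s)" for \<xi> \<xi>s
    by (simp add: C_def)
  have "multilinear_map N G M (Suc k) C"
    unfolding multilinear_map_def
  proof (intro conjI allI ballI impI; (elim conjE)?)
    fix \<xi>s assume "set \<xi>s \<subseteq> ?L" "length \<xi>s = Suc k"
    then show "C \<xi>s \<in> forms M"
      using B smooth by (cases \<xi>s) (auto simp: C_Cons multilinear_map_def intro!: forms_form_mult)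
  next
    fix \<xi>s \<eta>s \<xi> \<eta>
    assume *: "\<xi> \<in> ?L" "\<eta> \<in> ?L" "set \<xi>s \<subseteq> ?L" "set \<eta>s \<subseteq> ?L" "length \<xi>s + length \<eta>s + 1 = Suc k"
    show "C (\<xi>s @ (\<xi> + \<eta>) # \<eta>s) = C (\<xi>s @ \<xi> # \<eta>s) + C (\<xi>s @ \<eta> # \<eta>s)"
    proof (cases \<xi>s)
      case Nil
      have "form_mult (l \<xi> + l \<eta>) (B \<eta>s) = form_mult (l \<xi>) (B \<eta>s) + form_mult (l \<eta>) (B \<eta>s)"
        by (intro ext) (simp add: form_mult_def algebra_simps)
      then show ?thesis
        using * Nil by (simp only: append_Nil C_Cons add)
    next
      case (Cons \<zeta> \<zeta>s)
      then have "B (\<zeta>s @ (\<xi> + \<eta>) # \<eta>s) = B (\<zeta>s @ \<xi> # \<eta>s) + B (\<zeta>s @ \<eta> # \<eta>s)"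
        using B * unfolding multilinear_map_def by simp
      then show ?thesis
        by (simp only: Cons append_Cons C_Cons form_mult_add_right)
    qed
  next
    fix \<xi>s \<eta>s c \<xi>
    assume *: "\<xi> \<in> ?L" "set \<xi>s \<subseteq> ?L" "set \<eta>s \<subseteq> ?L" "length \<xi>s + length \<eta>s + 1 = Suc k"
    show "C (\<xi>s @ lie_scale c \<xi> # \<eta>s) = form_scale (of_real c) (C (\<xi>s @ \<xi> # \<eta>s))"
    proof (cases \<xi>s)
      case Nil
      have "form_mult (\<lambda>p. of_real c * l \<xi> p) (B \<eta>s) = form_scale (of_real c) (form_mult (l \<xi>) (B \<eta>s))"
        by (intro ext) (simp add: form_mult_def form_scale_def)
      then show ?thesis
        using * Nil by (simp only: append_Nil C_Cons scale)
    next
      case (Cons \<zeta> \<zeta>s)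
      then have "B (\<zeta>s @ lie_scale c \<xi> # \<eta>s) = form_scale (of_real c) (B (\<zeta>s @ \<xi> # \<eta>s))"
        using B * unfolding multilinear_map_def by simp
      then show ?thesis
        by (simp only: Cons append_Cons C_Cons form_scale_eq_form_mult form_mult_form_mult mult.commute)
    qed
  qed
  moreover have "\<forall>\<xi>\<in>?L. form_mult (l \<xi>) (P \<xi>) = C (replicate (Suc k) \<xi>)"
    using PB by (simp add: C_Cons)
  moreover have "form_mult (l \<xi>) (P \<xi>) = 0" if "\<xi> \<notin> ?L" for \<xi>
    using P that by (metis homogeneous_poly_outside form_mult_zero_right)
  ultimately show ?thesis
    unfolding homogeneous_poly_iff_multilinear_map by blast
qed

lemma homogeneous_poly_exp_coeff_mult:
  assumes P: "homogeneous_poly N G M m P"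
    and l: "\<And>\<xi>. \<xi> \<in> lie_algebra N G \<Longrightarrow> l \<xi> \<in> smooth_funs M"
      "\<And>\<xi> \<eta>. \<xi> \<in> lie_algebra N G \<Longrightarrow> \<eta> \<in> lie_algebra N G \<Longrightarrow> l (\<xi> + \<eta>) = l \<xi> + l \<eta>"
      "\<And>c \<xi>. \<xi> \<in> lie_algebra N G \<Longrightarrow> l (lie_scale c \<xi>) = (\<lambda>p. of_real c * l \<xi> p)"
  shows "homogeneous_poly N G M (k + m) (\<lambda>\<xi>. form_mult (exp_coeff (l \<xi>) k) (P \<xi>))"
proof (induction k)
  case 0
  show ?case using P by (simp only: exp_coeff_0 form_mult_one add_0)
next
  case (Suc k)
  have "form_mult (exp_coeff a (Suc k)) \<omega> =
      form_mult (\<lambda>p. 1 / of_nat (Suc k)) (form_mult a (form_mult (exp_coeff a k) \<omega>))"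
    for a and \<omega> :: "'c form"
    by (intro ext) (simp add: form_mult_def exp_coeff_Suc)
  moreover have "homogeneous_poly N G M (Suc (k + m))
      (\<lambda>\<xi>. form_mult (l \<xi>) (form_mult (exp_coeff (l \<xi>) k) (P \<xi>)))"
    by (rule homogeneous_poly_linear_mult[where l = l and P = "\<lambda>\<xi>. form_mult (exp_coeff (l \<xi>) k) (P \<xi>)"])
      (fact Suc l)+
  then have "homogeneous_poly N G M (Suc (k + m))
      (\<lambda>\<xi>. form_mult (\<lambda>p. 1 / of_nat (Suc k)) (form_mult (l \<xi>) (form_mult (exp_coeff (l \<xi>) k) (P \<xi>))))"
    by (rule homogeneous_poly_form_mult[OF _ smooth_funs_const])
  ultimately show ?case
    by (simp only: add_Suc)
qed


section \<open>The exponential of the moment map on the completed Cartan complex\<close>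

abbreviation moment_exponent :: "('m \<Rightarrow> 'g lie \<Rightarrow> real) \<Rightarrow> 'g lie \<Rightarrow> 'm \<Rightarrow> complex" where
  "moment_exponent \<mu> \<xi> \<equiv> (\<lambda>p. - \<i> * moment_fun \<mu> \<xi> p)"

lemma series_wedge_exp_moment:
  assumes "\<xi> \<in> lie_algebra N G"
  shows "series_wedge (exp_moment N G \<mu>) \<gamma> n \<xi> = exp_mult (moment_exponent \<mu> \<xi>) (\<lambda>n. \<gamma> n \<xi>) n"
  using assms by (simp add: series_wedge_def exp_moment_def wedge_fun_form exp_mult_def exp_coeff_def)

lemma series_wedge_exp_moment_outside:
  assumes "\<xi> \<notin> lie_algebra N G"
  shows "series_wedge (exp_moment N G \<mu>) \<gamma> n \<xi> = 0"
  using assms by (simp only: series_wedge_def exp_moment_def if_False wedge_zero_left sum.neutral_const)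

lemma completed_cartan_homogeneous:
  "\<gamma> \<in> completed_cartan N G M \<rho> \<Longrightarrow> homogeneous_poly N G M n (\<gamma> n)"
  by (simp add: completed_cartan_def)

lemma completed_cartan_invariant:
  assumes "\<gamma> \<in> completed_cartan N G M \<rho>" "\<xi> \<in> lie_algebra N G"
  shows "pull_form (\<rho> g) (\<gamma> n (Ad G g \<xi>)) = \<gamma> n \<xi>"
proof -
  have "G_invariant N G \<rho> \<gamma>"
    using assms(1) by (simp add: completed_cartan_def)
  then have "\<forall>n g. \<forall>\<xi>\<in>lie_algebra N G. pull_form (\<rho> g) (\<gamma> n (Ad G g \<xi>)) = \<gamma> n \<xi>"
    unfolding G_invariant_def .
  from this[THEN spec, THEN spec, THEN bspec, OF assms(2)] show ?thesis .
qed

lemma completed_cartan_forms: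
  assumes "\<gamma> \<in> completed_cartan N G M \<rho>"
  shows "\<gamma> n \<xi> \<in> forms M"
  using completed_cartan_homogeneous[OF assms, of n] by (rule homogeneous_poly_forms)

lemma completed_cartan_outside:
  assumes "\<gamma> \<in> completed_cartan N G M \<rho>" "\<xi> \<notin> lie_algebra N G"
  shows "\<gamma> n \<xi> = 0"
  using completed_cartan_homogeneous[OF assms(1), of n] assms(2) by (rule homogeneous_poly_outside)

lemma moment_exponent_smooth:
  assumes "equivariant_moment_map N G M \<rho> \<mu>" "\<xi> \<in> lie_algebra N G"
  shows "moment_exponent \<mu> \<xi> \<in> smooth_funs M"
  using assms unfolding equivariant_moment_map_def by (intro smooth_funs_cmult) blast

lemma pull_form_add: "pull_form \<phi> (\<omega> + \<eta>) = pull_form \<phi> \<omega> + pull_form \<phi> \<eta>"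
  by (intro ext) (simp add: pull_form_def)

lemma pull_form_zero: "pull_form \<phi> 0 = 0"
  by (intro ext) (simp add: pull_form_def)

lemma pull_form_sum: "pull_form \<phi> (\<Sum>k\<in>A. F k) = (\<Sum>k\<in>A. pull_form \<phi> (F k))"
  by (induction A rule: infinite_finite_induct)
    (simp_all only: sum.infinite sum.empty sum.insert not_False_eq_True pull_form_zero pull_form_add)

lemma pull_form_form_mult: "pull_form \<phi> (form_mult h \<omega>) = form_mult (h \<circ> \<phi>) (pull_form \<phi> \<omega>)"
  by (intro ext) (simp add: pull_form_def form_mult_def)

text \<open>
  Pull-back is multiplicative, hence compatible with exponentials; this reduces invariance of
  \<open>exp (- \<i> \<mu>) \<gamma>\<close> to invariance of \<open>\<gamma>\<close> and equivariance of \<open>\<mu>\<close>.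
\<close>

lemma pull_form_exp_mult:
  "pull_form \<phi> (exp_mult a w n) = exp_mult (a \<circ> \<phi>) (\<lambda>n. pull_form \<phi> (w n)) n"
proof -
  have "exp_coeff a k \<circ> \<phi> = exp_coeff (a \<circ> \<phi>) k" for k
    by (simp add: exp_coeff_def fun_eq_iff)
  then show ?thesis
    by (simp only: exp_mult_def pull_form_sum pull_form_form_mult)
qed

lemma Ad_inv_Ad:
  assumes "group G" "carrier G = UNIV"
  shows "Ad G (inv\<^bsub>G\<^esub> g) (Ad G g \<xi>) = \<xi>"
proof -
  interpret group G by fact
  have "inv\<^bsub>G\<^esub> g \<otimes>\<^bsub>G\<^esub> (g \<otimes>\<^bsub>G\<^esub> h \<otimes>\<^bsub>G\<^esub> inv\<^bsub>G\<^esub> g) \<otimes>\<^bsub>G\<^esub> inv\<^bsub>G\<^esub> (inv\<^bsub>G\<^esub> g) = h" for h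
  proof -
    have c: "x \<in> carrier G" for x using assms(2) by simp
    have "inv\<^bsub>G\<^esub> g \<otimes>\<^bsub>G\<^esub> (g \<otimes>\<^bsub>G\<^esub> h \<otimes>\<^bsub>G\<^esub> inv\<^bsub>G\<^esub> g) \<otimes>\<^bsub>G\<^esub> inv\<^bsub>G\<^esub> (inv\<^bsub>G\<^esub> g) =
        (inv\<^bsub>G\<^esub> g \<otimes>\<^bsub>G\<^esub> g) \<otimes>\<^bsub>G\<^esub> h \<otimes>\<^bsub>G\<^esub> (inv\<^bsub>G\<^esub> g \<otimes>\<^bsub>G\<^esub> inv\<^bsub>G\<^esub> (inv\<^bsub>G\<^esub> g))"
      by (simp only: m_assoc[OF c c c])
    then show ?thesis
      by (simp only: l_inv[OF c] r_inv[OF c] l_one[OF c] r_one[OF c])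
  qed
  then show ?thesis
    by (simp add: Ad_def)
qed

text \<open>
  Each component is a finite sum of products of powers of \<open>\<mu>\<^sup>\<xi>\<close>, which are polynomial in
  \<open>\<xi>\<close>, with components of \<open>\<gamma>\<close>. Invariance follows from
  \<open>\<mu> (g p) (Ad g \<xi>) = \<mu> p (Ad g\<^sup>-\<^sup>1 (Ad g \<xi>)) = \<mu> p \<xi>\<close>.
\<close>

lemma exp_moment_preserves_completed_cartan:
  assumes G: "group G" "carrier G = UNIV"
    and \<mu>: "equivariant_moment_map N G M \<rho> \<mu>"
    and \<gamma>: "\<gamma> \<in> completed_cartan N G M \<rho>"
  shows "series_wedge (exp_moment N G \<mu>) \<gamma> \<in> completed_cartan N G M \<rho>"
proof -
  let ?L = "lie_algebra N G" and ?a = "moment_exponent \<mu>" and ?E = "series_wedge (exp_moment N G \<mu>) \<gamma>"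
  have homogeneous: "homogeneous_poly N G M n (?E n)" for n
  proof -
    have *: "homogeneous_poly N G M (k + (n - k)) (\<lambda>\<xi>. form_mult (exp_coeff (?a \<xi>) k) (\<gamma> (n - k) \<xi>))" for k
    proof (rule homogeneous_poly_exp_coeff_mult)
      show "homogeneous_poly N G M (n - k) (\<gamma> (n - k))"
        using \<gamma> by (rule completed_cartan_homogeneous)
      show "?a \<xi> \<in> smooth_funs M" if "\<xi> \<in> ?L" for \<xi>
        using moment_exponent_smooth[OF \<mu> that] .
      show "?a (\<xi> + \<eta>) = ?a \<xi> + ?a \<eta>" if "\<xi> \<in> ?L" "\<eta> \<in> ?L" for \<xi> \<eta>
        using \<mu> that by (auto simp: equivariant_moment_map_def moment_fun_def algebra_simps)
      show "?a (lie_scale c \<xi>) = (\<lambda>p. of_real c * ?a \<xi> p)" if "\<xi> \<in> ?L" for c \<xi>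
        using \<mu> that by (auto simp: equivariant_moment_map_def moment_fun_def)
    qed
    have "homogeneous_poly N G M n (\<lambda>\<xi>. form_mult (exp_coeff (?a \<xi>) k) (\<gamma> (n - k) \<xi>))"
      if "k \<in> {..n}" for k
      using *[of k] that by (simp only: atMost_iff le_add_diff_inverse)
    then have "homogeneous_poly N G M n (\<lambda>\<xi>. \<Sum>k\<le>n. form_mult (exp_coeff (?a \<xi>) k) (\<gamma> (n - k) \<xi>))"
      by (rule homogeneous_poly_sum)
    moreover have "(\<lambda>\<xi>. \<Sum>k\<le>n. form_mult (exp_coeff (?a \<xi>) k) (\<gamma> (n - k) \<xi>)) = ?E n"
    proof
      fix \<xi>
      show "(\<Sum>k\<le>n. form_mult (exp_coeff (?a \<xi>) k) (\<gamma> (n - k) \<xi>)) = ?E n \<xi>"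
      proof (cases "\<xi> \<in> ?L")
        case True
        then show ?thesis by (simp only: series_wedge_exp_moment exp_mult_def)
      next
        case False
        show ?thesis
          by (simp only: completed_cartan_outside[OF \<gamma> False] series_wedge_exp_moment_outside[OF False]
              form_mult_zero_right sum.neutral_const)
      qed
    qed
    ultimately show ?thesis by (simp only:)
  qed
  have invariant: "pull_form (\<rho> g) (?E n (Ad G g \<xi>)) = ?E n \<xi>" if \<xi>: "\<xi> \<in> ?L" for n g \<xi>
  proof -
    have inv: "pull_form (\<rho> g) (\<gamma> k (Ad G g \<xi>)) = \<gamma> k \<xi>" for k
      using \<gamma> \<xi> by (rule completed_cartan_invariant)
    show ?thesis
    proof (cases "Ad G g \<xi> \<in> ?L")
      case True
      have "\<mu> (\<rho> g p) (Ad G g \<xi>) = \<mu> p \<xi>" for p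
      proof -
        have "\<forall>g p. \<forall>\<xi>\<in>?L. \<mu> (\<rho> g p) \<xi> = \<mu> p (Ad G (inv\<^bsub>G\<^esub> g) \<xi>)"
          using \<mu> unfolding equivariant_moment_map_def by (elim conjE)
        from this[THEN spec, THEN spec, THEN bspec, OF True] show ?thesis
          by (simp only: Ad_inv_Ad[OF G])
      qed
      then have "?a (Ad G g \<xi>) \<circ> \<rho> g = ?a \<xi>"
        by (simp add: moment_fun_def o_def)
      then show ?thesis
        by (simp only: series_wedge_exp_moment[OF True] series_wedge_exp_moment[OF \<xi>]
            pull_form_exp_mult inv)
    next
      \<comment> \<open>For a Lie group, \<open>Ad g\<close> preserves the Lie algebra because conjugation is smooth. The
        chain rule behind this is bypassed: components vanish outside the Lie algebra, so here
        invariance makes both sides 0.\<close>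
      case False
      have "\<gamma> k \<xi> = 0" for k
        using inv[of k] unfolding completed_cartan_outside[OF \<gamma> False] pull_form_zero by (rule sym)
      then show ?thesis
        by (simp only: series_wedge_exp_moment[OF \<xi>] series_wedge_exp_moment_outside[OF False]
            pull_form_zero exp_mult_zero)
    qed
  qed
  show ?thesis
    unfolding completed_cartan_def G_invariant_def
    by (intro CollectI conjI allI ballI homogeneous invariant)
qed

lemma equivariant_moment_map_minus:
  "equivariant_moment_map N G M \<rho> \<mu> \<Longrightarrow> equivariant_moment_map N G M \<rho> (\<lambda>p \<xi>. - \<mu> p \<xi>)"
  unfolding equivariant_moment_map_def
  using smooth_funs_cmult[of "moment_fun \<mu> _" M "-1"] by (simp add: moment_fun_def)

text \<open>
  Both factors vanish for \<open>\<xi>\<close> outside the Lie algebra, so the inverse property is confined to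
  series that are normalised to vanish there.
\<close>

lemma exp_moment_inverse:
  assumes "\<And>n \<xi>. \<xi> \<notin> lie_algebra N G \<Longrightarrow> \<gamma> n \<xi> = 0"
  shows "series_wedge (exp_moment N G (\<lambda>p \<xi>. - \<mu> p \<xi>)) (series_wedge (exp_moment N G \<mu>) \<gamma>) = \<gamma>"
proof (rule ext, rule ext)
  fix n \<xi>
  show "series_wedge (exp_moment N G (\<lambda>p \<xi>. - \<mu> p \<xi>)) (series_wedge (exp_moment N G \<mu>) \<gamma>) n \<xi> = \<gamma> n \<xi>"
  proof (cases "\<xi> \<in> lie_algebra N G")
    case True
    have "moment_exponent (\<lambda>p \<xi>. - \<mu> p \<xi>) \<xi> = - moment_exponent \<mu> \<xi>"
      by (simp add: moment_fun_def fun_eq_iff)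
    then show ?thesis
      by (simp only: series_wedge_exp_moment[OF True] exp_mult_inverse)
  next
    case False
    show ?thesis
      by (simp only: assms[OF False] series_wedge_exp_moment_outside[OF False])
  qed
qed

lemma series_wedge_add_right: "series_wedge \<beta> (\<gamma> + \<delta>) = series_wedge \<beta> \<gamma> + series_wedge \<beta> \<delta>"
  by (rule ext, rule ext) (simp only: series_wedge_def plus_fun_apply wedge_add_right sum.distrib)

lemma series_wedge_zero_right: "series_wedge \<beta> 0 = 0"
  by (rule ext, rule ext) (simp only: series_wedge_def zero_fun_apply wedge_zero_right sum.neutral_const)

lemma series_wedge_scale_right: "series_wedge \<beta> (series_scale c \<gamma>) = series_scale c (series_wedge \<beta> \<gamma>)"
  by (rule ext, rule ext) (simp only: series_wedge_def series_scale_def form_scale_eq_form_mult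
      wedge_form_mult_right form_mult_sum_right)


section \<open>Conjugating one differential into the other\<close>

lemma twisted_d_exp_mult:
  assumes "a \<in> smooth_funs M" "\<And>n. w n \<in> forms M"
  shows "twisted_d M H (exp_mult a w n) = exp_mult a (\<lambda>n. twisted_d M H (w n)) n +
           case_nat 0 (\<lambda>m. wedge (ext_d M (fun_form a)) (exp_mult a w m)) n"
  by (simp only: twisted_d_def ext_d_exp_mult[OF assms] exp_mult_diff exp_mult_wedge)
    (simp only: add_diff_eq diff_add_eq)

lemma twisted_equiv_d_eq:
  assumes "\<xi> \<in> lie_algebra N G"
  shows "twisted_equiv_d N G M \<rho> H \<alpha> \<gamma> n \<xi> = twisted_d M H (\<gamma> n \<xi>) -
           case_nat 0 (\<lambda>m. interior (fundamental_vf M \<rho> \<xi>) (\<gamma> m \<xi>) + wedge (\<alpha> \<xi>) (\<gamma> m \<xi>)) n"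
proof (cases n)
  case 0
  then show ?thesis
    using assms by (simp add: twisted_equiv_d_def equiv_d_def series_wedge_def equiv_3form_def twisted_d_def)
next
  case (Suc m)
  have vanish: "wedge (equiv_3form N G H \<alpha> (Suc k) \<xi>) \<omega> = 0" if "k \<noteq> 0" for k \<omega>
  proof -
    have "equiv_3form N G H \<alpha> (Suc k) \<xi> = 0"
      using that by (simp add: equiv_3form_def)
    then show ?thesis by (simp only: wedge_zero_left)
  qed
  have "(\<Sum>k\<le>m. wedge (equiv_3form N G H \<alpha> (Suc k) \<xi>) (\<gamma> (m - k) \<xi>)) =
      (\<Sum>k\<in>{0}. wedge (equiv_3form N G H \<alpha> (Suc k) \<xi>) (\<gamma> (m - k) \<xi>))"
    by (rule sum.mono_neutral_right; (intro ballI vanish)?) simp_all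
  also have "\<dots> = wedge (\<alpha> \<xi>) (\<gamma> m \<xi>)"
    using assms by (simp add: equiv_3form_def)
  finally have "series_wedge (equiv_3form N G H \<alpha>) \<gamma> n \<xi> = wedge H (\<gamma> n \<xi>) + wedge (\<alpha> \<xi>) (\<gamma> m \<xi>)"
    using assms by (simp only: series_wedge_def Suc sum.atMost_Suc_shift diff_Suc_Suc) 
      (simp add: equiv_3form_def)
  then show ?thesis
    by (simp add: twisted_equiv_d_def equiv_d_def twisted_d_def Suc)
qed

text \<open>
  Compared with \<open>twisted_equiv_d_eq\<close> there is one additional summand, coming from
  \<open>d\<mu>\<^sup>\<xi>\<close>: the contribution of \<open>\<i> \<alpha>\<^sup>\<xi>\<close> to the one-form is \<open>\<i> \<i> \<alpha>\<^sup>\<xi> = - \<alpha>\<^sup>\<xi>\<close>.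
\<close>

lemma generalized_equiv_d_eq:
  "generalized_equiv_d M \<rho> H \<mu> \<alpha> \<gamma> n \<xi> = twisted_d M H (\<gamma> n \<xi>) -
     case_nat 0 (\<lambda>m. interior (fundamental_vf M \<rho> \<xi>) (\<gamma> m \<xi>) + wedge (\<alpha> \<xi>) (\<gamma> m \<xi>)) n +
     case_nat 0 (\<lambda>m. form_scale \<i> (wedge (ext_d M (fun_form (moment_fun \<mu> \<xi>))) (\<gamma> m \<xi>))) n"
proof -
  have "wedge (form_scale \<i> (moment_1form M \<mu> \<alpha> \<xi>)) \<omega> =
      form_scale \<i> (wedge (ext_d M (fun_form (moment_fun \<mu> \<xi>))) \<omega>) - wedge (\<alpha> \<xi>) \<omega>" for \<omega>
  proof -
    have "form_scale \<i> (form_scale \<i> \<eta>) = - \<eta>" for \<eta> :: "'a form"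
      by (intro ext) (simp add: form_scale_def flip: mult.assoc)
    then have "form_scale \<i> (wedge (form_scale \<i> (\<alpha> \<xi>)) \<omega>) = - wedge (\<alpha> \<xi>) \<omega>"
      by (simp only: form_scale_eq_form_mult wedge_form_mult_left)
    then show ?thesis
      by (simp only: moment_1form_def form_scale_eq_form_mult form_mult_add_right
          wedge_add_left wedge_form_mult_left diff_conv_add_uminus)
  qed
  then show ?thesis
    by (cases n) (simp_all add: generalized_equiv_d_def moment_op_def)
qed

text \<open>
  With \<open>a = - \<i> \<mu>\<^sup>\<xi>\<close>, differentiating the exponential produces \<open>da = - \<i> d\<mu>\<^sup>\<xi>\<close>, which
  cancels the summand \<open>\<i> d\<mu>\<^sup>\<xi>\<close> that distinguishes the two differentials.
\<close>

lemma generalized_equiv_d_exp_moment: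
  assumes \<mu>: "equivariant_moment_map N G M \<rho> \<mu>" and \<gamma>: "\<gamma> \<in> completed_cartan N G M \<rho>"
  shows "generalized_equiv_d M \<rho> H \<mu> \<alpha> (series_wedge (exp_moment N G \<mu>) \<gamma>) =
           series_wedge (exp_moment N G \<mu>) (twisted_equiv_d N G M \<rho> H \<alpha> \<gamma>)"
proof (rule ext, rule ext)
  fix n \<xi>
  let ?E = "series_wedge (exp_moment N G \<mu>)"
  show "generalized_equiv_d M \<rho> H \<mu> \<alpha> (?E \<gamma>) n \<xi> = ?E (twisted_equiv_d N G M \<rho> H \<alpha> \<gamma>) n \<xi>"
  proof (cases "\<xi> \<in> lie_algebra N G")
    case True
    define a where "a = moment_exponent \<mu> \<xi>"
    define w where "w = (\<lambda>n. \<gamma> n \<xi>)"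
    define B where "B = (\<lambda>\<omega>. interior (fundamental_vf M \<rho> \<xi>) \<omega> + wedge (\<alpha> \<xi>) \<omega>)"
    define d\<mu> where "d\<mu> = ext_d M (fun_form (moment_fun \<mu> \<xi>))"
    have a: "a \<in> smooth_funs M"
      unfolding a_def using \<mu> True by (rule moment_exponent_smooth)
    have w: "w n \<in> forms M" for n
      unfolding w_def using \<gamma> by (rule completed_cartan_forms)
    have E: "?E \<gamma> n \<xi> = exp_mult a w n" for n
      by (simp only: series_wedge_exp_moment[OF True] a_def w_def)
    have da: "ext_d M (fun_form a) = form_scale (- \<i>) d\<mu>"
      unfolding a_def d\<mu>_def using \<mu> True
      by (intro ext_d_fun_form_cmult) (simp add: equivariant_moment_map_def)
    have B: "B (exp_mult a w m) = exp_mult a (\<lambda>n. B (w n)) m" for m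
      by (simp only: B_def exp_mult_add exp_mult_interior exp_mult_wedge)
    have "generalized_equiv_d M \<rho> H \<mu> \<alpha> (?E \<gamma>) n \<xi> =
        exp_mult a (\<lambda>n. twisted_d M H (w n)) n
        + case_nat 0 (\<lambda>m. wedge (form_scale (- \<i>) d\<mu>) (exp_mult a w m)) n
        - case_nat 0 (\<lambda>m. B (exp_mult a w m)) n
        + case_nat 0 (\<lambda>m. form_scale \<i> (wedge d\<mu> (exp_mult a w m))) n"
      by (simp only: generalized_equiv_d_eq E twisted_d_exp_mult[OF a w] da B_def d\<mu>_def)
    also have "\<dots> = exp_mult a (\<lambda>n. twisted_d M H (w n)) n - case_nat 0 (\<lambda>m. B (exp_mult a w m)) n
        + (case_nat 0 (\<lambda>m. wedge (form_scale (- \<i>) d\<mu>) (exp_mult a w m)) n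
          + case_nat 0 (\<lambda>m. form_scale \<i> (wedge d\<mu> (exp_mult a w m))) n)"
      by (simp only: algebra_simps)
    also have "case_nat 0 (\<lambda>m. wedge (form_scale (- \<i>) d\<mu>) (exp_mult a w m)) n
        + case_nat 0 (\<lambda>m. form_scale \<i> (wedge d\<mu> (exp_mult a w m))) n = 0"
    proof -
      have "wedge (form_scale (- \<i>) d\<mu>) \<omega> + form_scale \<i> (wedge d\<mu> \<omega>) = 0" for \<omega>
      proof -
        have "wedge (form_scale (- \<i>) d\<mu>) \<omega> = form_scale (- \<i>) (wedge d\<mu> \<omega>)"
          by (simp only: form_scale_eq_form_mult wedge_form_mult_left)
        then show ?thesis
          by (intro ext) (simp add: form_scale_def)
      qed
      then show ?thesis
        by (cases n) (simp_all only: nat.case add_0_left)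
    qed
    also have "exp_mult a (\<lambda>n. twisted_d M H (w n)) n - case_nat 0 (\<lambda>m. B (exp_mult a w m)) n + 0 =
        exp_mult a (\<lambda>n. twisted_d M H (w n)) n - case_nat 0 (\<lambda>m. B (exp_mult a w m)) n"
      by (rule add_0_right)
    also have "\<dots> = exp_mult a (\<lambda>n. twisted_d M H (w n)) n - exp_mult a (case_nat 0 (\<lambda>m. B (w m))) n"
      by (simp only: B exp_mult_shift)
    also have "\<dots> = exp_mult a (\<lambda>n. twisted_equiv_d N G M \<rho> H \<alpha> \<gamma> n \<xi>) n"
      by (simp only: twisted_equiv_d_eq[OF True] exp_mult_diff w_def B_def)
    also have "\<dots> = ?E (twisted_equiv_d N G M \<rho> H \<alpha> \<gamma>) n \<xi>"
      by (simp only: series_wedge_exp_moment[OF True] a_def)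
    finally show ?thesis .
  next
    case False
    have "twisted_d M H 0 = 0"
      by (simp only: twisted_d_def ext_d_zero wedge_zero_right diff_self)
    moreover have "?E \<gamma> k \<xi> = 0" for k
      using False by (rule series_wedge_exp_moment_outside)
    ultimately show ?thesis
      unfolding series_wedge_exp_moment_outside[OF False] generalized_equiv_d_eq
      by (cases n) (simp_all only: nat.case interior_zero wedge_zero_right form_scale_eq_form_mult
          form_mult_zero_right add_0_left diff_self)
  qed
qed

lemma twisted_equiv_d_outside:
  assumes "\<gamma> \<in> completed_cartan N G M \<rho>" "\<xi> \<notin> lie_algebra N G"
  shows "twisted_equiv_d N G M \<rho> H \<alpha> \<gamma> n \<xi> = 0"
proof -
  have "series_wedge (equiv_3form N G H \<alpha>) \<gamma> n \<xi> = 0"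
    using assms(2) by (simp only: series_wedge_def equiv_3form_def if_False wedge_zero_left sum.neutral_const)
  moreover have "equiv_d M \<rho> \<gamma> n \<xi> = 0"
    unfolding equiv_d_def completed_cartan_outside[OF assms]
    by (cases n) (simp_all only: nat.case ext_d_zero interior_zero diff_self)
  ultimately show ?thesis
    by (simp add: twisted_equiv_d_def)
qed


section \<open>Isomorphisms on cohomology from conjugation\<close>

text \<open>
  The image under E of the coset \<open>x + D C\<close> is \<open>E x + D' (E C) = E x + D' C\<close>, so taking images
  is the induced map on cohomology. Injectivity is required on a set Z larger than C because the cosets
  lie in \<open>C + D C\<close>.
\<close>

lemma cohomology_iso_conjugation:
  fixes E :: "('g, 'm) fseries \<Rightarrow> ('g, 'm) fseries"
  assumes add: "\<And>x y. E (x + y) = E x + E y"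
    and scale: "\<And>c x. E (series_scale c x) = series_scale c (E x)"
    and zero: "E 0 = 0"
    and onto: "E ` C = C"
    and conj: "\<And>x. x \<in> C \<Longrightarrow> D' (E x) = E (D x)"
    and inj: "inj_on E Z"
    and Z: "C \<subseteq> Z" "D ` C \<subseteq> Z" "0 \<in> Z" "\<And>x y. x \<in> Z \<Longrightarrow> y \<in> Z \<Longrightarrow> x + y \<in> Z"
  shows "(\<forall>x\<in>cocycles C D. E x \<in> cocycles C D' \<and> E ` coh_class C D x = coh_class C D' (E x)) \<and>
         cohomology_iso C D D' (image E)"
proof -
  have class_image: "E ` coh_class C D x = coh_class C D' (E x)" for x
  proof -
    have "E ` coh_class C D x = (\<lambda>y. E (x + D y)) ` C"
      by (simp only: coh_class_def setcompr_eq_image Collect_mem_eq image_image)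
    also have "\<dots> = (\<lambda>y. E x + D' (E y)) ` C"
      by (intro image_cong refl) (simp only: add conj)
    also have "\<dots> = (\<lambda>y. E x + D' y) ` E ` C"
      by (simp only: image_image)
    finally show ?thesis
      by (simp only: onto coh_class_def setcompr_eq_image Collect_mem_eq)
  qed
  have cocycles: "E ` cocycles C D = cocycles C D'"
  proof (intro equalityI subsetI)
    fix y assume "y \<in> E ` cocycles C D"
    then obtain x where x: "x \<in> C" "D x = 0" "y = E x"
      by (auto simp only: cocycles_def)
    have "y \<in> C"
      using x(1) onto unfolding x(3) by (metis imageI)
    moreover have "D' y = 0"
      by (simp only: x(3) conj[OF x(1)] x(2) zero)
    ultimately show "y \<in> cocycles C D'"
      unfolding cocycles_def by (intro CollectI conjI)
  next
    fix y assume "y \<in> cocycles C D'"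
    then have y: "y \<in> E ` C" "D' y = 0"
      by (simp_all only: cocycles_def mem_Collect_eq onto)
    then obtain x where x: "x \<in> C" "y = E x"
      by (elim imageE)
    have "E (D x) = E 0"
      using y(2) by (simp only: x(2) conj[OF x(1)] zero)
    then have "D x = 0"
      by (rule inj_onD[OF inj]) (use Z x(1) in auto)
    then show "y \<in> E ` cocycles C D"
      unfolding x(2) cocycles_def by (intro imageI CollectI conjI x(1))
  qed
  have "cohomology C D \<subseteq> Pow Z"
  proof -
    have "x + D y \<in> Z" if "x \<in> C" "y \<in> C" for x y
      using that Z(1,2) by (intro Z(4)) auto
    then show ?thesis
      by (auto simp only: cohomology_def cocycles_def coh_class_def)
  qed
  then have "inj_on (image E) (cohomology C D)"
    by (rule inj_on_subset[OF inj_on_image_Pow[OF inj]])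
  moreover have "image E ` cohomology C D = cohomology C D'"
    by (simp only: cohomology_def cocycles[symmetric] image_image class_image)
  ultimately have bij: "bij_betw (image E) (cohomology C D) (cohomology C D')"
    by (rule bij_betw_imageI)
  have coh_add: "E ` coh_add a b = coh_add (E ` a) (E ` b)" for a b
  proof -
    have sum_image: "coh_add a b = (\<Union>x\<in>a. (\<lambda>y. x + y) ` b)" for a b :: "('g, 'm) fseries set"
      by (auto simp only: coh_add_def)
    show ?thesis
      by (simp only: sum_image image_UN image_image add)
  qed
  have coh_scale: "E ` coh_scale C D c a = coh_scale C D' c (E ` a)" for c a
  proof -
    have sum_image: "coh_scale C d c a = (\<Union>x\<in>a. (\<lambda>y. series_scale c x + d y) ` C)" for d a
      by (auto simp only: coh_scale_def)
    have "E ` coh_scale C D c a = (\<Union>x\<in>a. (\<lambda>y. series_scale c (E x) + D' (E y)) ` C)"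
      unfolding sum_image image_UN image_image
      by (intro SUP_cong image_cong refl) (simp only: add scale conj)
    also have "\<dots> = (\<Union>x\<in>E ` a. (\<lambda>y. series_scale c x + D' y) ` E ` C)"
      by (simp only: image_image)
    finally show ?thesis
      by (simp only: onto sum_image)
  qed
  have "E x \<in> cocycles C D'" if "x \<in> cocycles C D" for x
    unfolding cocycles[symmetric] using that by (rule imageI)
  then show ?thesis
    unfolding cohomology_iso_def
    by (intro conjI ballI allI bij coh_add coh_scale class_image)
qed

theorem proposition4p3:
  fixes N :: "('g::{t2_space,second_countable_topology}, 'f::euclidean_space) manifold"
    and G :: "'g monoid"
    and M :: "('m::{t2_space,second_countable_topology}, 'e::euclidean_space) manifold"
    and \<rho> :: "'g \<Rightarrow> 'm \<Rightarrow> 'm"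
    and H :: "'m form"
    and J :: "'m gsection \<Rightarrow> 'm gsection"
    and \<mu> :: "'m \<Rightarrow> 'g lie \<Rightarrow> real"
    and \<alpha> :: "'g lie \<Rightarrow> 'm form"
  assumes "lie_group N G"
    and "compact (UNIV :: 'g set)"
    and "connected (UNIV :: 'g set)"
    and "smooth_manifold M"
    and "closed_real_3form M H"
    and "gen_complex_structure M H J"
    and "hamiltonian_action N G M \<rho> H J \<mu> \<alpha>"
  defines "\<Omega> \<equiv> completed_cartan N G M \<rho>"
    and "d \<equiv> twisted_equiv_d N G M \<rho> H \<alpha>"
    and "D \<equiv> generalized_equiv_d M \<rho> H \<mu> \<alpha>"
    and "E \<equiv> series_wedge (exp_moment N G \<mu>)"
  shows "\<exists>\<Phi>. (\<forall>\<gamma>\<in>cocycles \<Omega> d. E \<gamma> \<in> cocycles \<Omega> D \<and>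
                 \<Phi> (coh_class \<Omega> d \<gamma>) = coh_class \<Omega> D (E \<gamma>)) \<and>
             cohomology_iso \<Omega> d D \<Phi>"
proof -
  have group: "group G" "carrier G = UNIV"
    using assms(1) by (simp_all add: lie_group_def)
  have \<mu>: "equivariant_moment_map N G M \<rho> \<mu>"
    using assms(7) by (simp add: hamiltonian_action_def)
  define E' where "E' = series_wedge (exp_moment N G (\<lambda>p \<xi>. - \<mu> p \<xi>))"
  \<comment> \<open>The series on which the exponentials of \<open>\<mu>\<close> and \<open>- \<mu>\<close> are inverse to each other; it contains
    both the complex and the image of its differential.\<close>
  define Z :: "('g, 'm) fseries set" where "Z = {\<gamma>. \<forall>n \<xi>. \<xi> \<notin> lie_algebra N G \<longrightarrow> \<gamma> n \<xi> = 0}"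
  have E_\<Omega>: "E \<gamma> \<in> \<Omega>" "E' \<gamma> \<in> \<Omega>" if "\<gamma> \<in> \<Omega>" for \<gamma>
  proof -
    have "\<gamma> \<in> completed_cartan N G M \<rho>"
      using that by (simp add: \<Omega>_def)
    then show "E \<gamma> \<in> \<Omega>" "E' \<gamma> \<in> \<Omega>"
      unfolding E_def E'_def \<Omega>_def
      using exp_moment_preserves_completed_cartan[OF group \<mu>]
        exp_moment_preserves_completed_cartan[OF group equivariant_moment_map_minus[OF \<mu>]] by simp_all
  qed
  have \<Omega>_Z: "\<Omega> \<subseteq> Z"
  proof
    fix \<gamma> assume "\<gamma> \<in> \<Omega>"
    then have "\<gamma> \<in> completed_cartan N G M \<rho>"
      by (simp only: \<Omega>_def)
    then have "\<gamma> n \<xi> = 0" if "\<xi> \<notin> lie_algebra N G" for n \<xi>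
      using that by (rule completed_cartan_outside[of \<gamma>])
    then show "\<gamma> \<in> Z"
      unfolding Z_def by (intro CollectI allI impI)
  qed
  have E'_E: "E' (E \<gamma>) = \<gamma>" if "\<gamma> \<in> Z" for \<gamma>
    unfolding E_def E'_def by (rule exp_moment_inverse) (use that in \<open>simp add: Z_def\<close>)
  have E_E': "E (E' \<gamma>) = \<gamma>" if "\<gamma> \<in> Z" for \<gamma>
    unfolding E_def E'_def
    by (rule exp_moment_inverse[where \<mu> = "\<lambda>p \<xi>. - \<mu> p \<xi>", unfolded minus_minus])
      (use that in \<open>simp add: Z_def\<close>)
  have "(\<forall>\<gamma>\<in>cocycles \<Omega> d. E \<gamma> \<in> cocycles \<Omega> D \<and> E ` coh_class \<Omega> d \<gamma> = coh_class \<Omega> D (E \<gamma>)) \<and>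
      cohomology_iso \<Omega> d D (image E)"
  proof (rule cohomology_iso_conjugation)
    show "E (x + y) = E x + E y" for x y
      unfolding E_def by (rule series_wedge_add_right)
    show "E (series_scale c x) = series_scale c (E x)" for c x
      unfolding E_def by (rule series_wedge_scale_right)
    show "E 0 = 0"
      unfolding E_def by (rule series_wedge_zero_right)
    show "E ` \<Omega> = \<Omega>"
    proof (intro equalityI subsetI)
      fix \<gamma> assume "\<gamma> \<in> \<Omega>"
      then have "E (E' \<gamma>) \<in> E ` \<Omega>" "E (E' \<gamma>) = \<gamma>"
        using E_\<Omega> E_E' \<Omega>_Z by auto
      then show "\<gamma> \<in> E ` \<Omega>" by (simp only:)
    qed (use E_\<Omega> in auto)
    show "D (E x) = E (d x)" if "x \<in> \<Omega>" for x
      using generalized_equiv_d_exp_moment[OF \<mu>] that unfolding D_def E_def d_def \<Omega>_def .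
    show "inj_on E Z"
      by (rule inj_on_inverseI[where g = E']) (rule E'_E)
    show "\<Omega> \<subseteq> Z" by (rule \<Omega>_Z)
    show "d ` \<Omega> \<subseteq> Z"
      unfolding Z_def d_def \<Omega>_def
      by (intro image_subsetI CollectI allI impI twisted_equiv_d_outside)
    show "0 \<in> Z" by (simp add: Z_def)
    show "x + y \<in> Z" if "x \<in> Z" "y \<in> Z" for x y
      using that by (simp add: Z_def)
  qed
  then show ?thesis
    by (intro exI[where x = "image E"])
qed

end
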